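(* Let $T,N\ge 1$ be integers. Let $(X_t)_{t\in\mathbb Z}$ be a real-valued process satisfying the sub-linear property $$|X_t|\le\sum_{j\in\mathbb Z}A_t(j)Z_{t-j},\qquad t\in\mathbb Z,$$ where $(Z_t)_{t\in\mathbb Z}$ is a process of nonnegative random variables and $(A_t(j))_{t,j\in\mathbb Z}$ are nonnegative (deterministic) coefficients with $A_*:=\sup_{t\in\mathbb Z}\sum_{j\in\mathbb Z}A_t(j)<\infty$. Let $\{(\widehat X_t^{(i)})_{1\le t\le T},\ 1\le i\le N\}$ be a collection of sequences of $L$-Lipschitz predictors of $(X_t)$, where $L=(L_s)_{s\ge1}$ is a sequence of nonnegative numbers with $L_*:=\sum_{j\ge1}L_j<\infty$. (i) Assume $m_4:=\sup_{t\in\mathbb Z}\mathbb E[Z_t^4]<\infty$ and let $\widehat X=(\widehat X_t)_{1\le t\le T}$ be the aggregated predictor obtained with the gradient-based weights (Strategy 1) with any $\eta>0$. Then $$\frac1T\sum_{t=1}^T\mathbb E[(\widehat X_t-X_t)^2]\le\inf_{\nu\in\mathcal S_N}\frac1T\sum_{t=1}^T\mathbb E[(\widehat X_t^{[\nu]}-X_t)^2]+\frac{\log N}{T\eta}+2\eta(1+L_* )^4A_*^4m_4.$$ (ii) Assume $m_p:=\sup_{t\in\mathbb Z}\mathbb E[Z_t^p]<\infty$ for a given $p>2$ and let $\widehat X$ be the aggregated predictor obtained with the quadratic-loss weights (Strategy 2) with any $\eta>0$. Then $$\frac1T\sum_{t=1}^T\mathbb E[(\widehat X_t-X_t)^2]\le\min_{1\le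 i\le N}\frac1T\sum_{t=1}^T\mathbb E[(\widehat X_t^{(i)}-X_t)^2]+\frac{\log N}{T\eta}+(2\eta)^{p/2-1}A_*^p(1+L_* )^pm_p.$$ (iii) Assume that $(Z_t)_{t\in\mathbb Z}$ is a sequence of independent random variables and that $\phi(\zeta):=\sup_{t\in\mathbb Z}\mathbb E[e^{\zeta Z_t}]<\infty$ for some $\zeta>0$, and let $\widehat X$ be the aggregated predictor obtained with the quadratic-loss weights (Strategy 2) with $\eta>0$. Then, for any $$\lambda\in\Big(0,\frac{\zeta}{a^*(L_*+1)}\Big],\qquad\text{where } a^*:=\sup_{j\in\mathbb Z}\sup_{t\in\mathbb Z}A_t(j)\le A_*,$$ we have $$\frac1T\sum_{t=1}^T\mathbb E[(\widehat X_t-X_t)^2]\le\min_{1\le i\le N}\frac1T\sum_{t=1}^T\mathbb E[(\widehat X_t^{(i)}-X_t)^2]+\frac{\log N}{T\eta}+\frac2e\lambda^{-2}\big(2+\lambda(2\eta)^{-1/2}\big)e^{-\lambda(2\eta)^{-1/2}}\big(\phi(\zeta)\big)^{\lambda A_*(1+L_* )/\zeta}.$$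
   Context: A predictor of $X_t$ is a measurable function of the past $(X_s)_{s\le t-1}$. A predictor $\widehat X_t$ of $X_t$ is $L$-Lipschitz, for a sequence $L=(L_s)_{s\ge1}$ of nonnegative numbers, if $|\widehat X_t|\le\sum_{s\ge1}L_s|X_{t-s}|$. Simplex: $\mathcal S_N=\{s=(s_1,\dots,s_N)\in\mathbb R_+^N:\sum_{i=1}^Ns_i=1\}$. For $\nu\in\mathcal S_N$, $\widehat X_t^{[\nu]}=\sum_{i=1}^N\nu_i\widehat X_t^{(i)}$. Aggregated predictor: $\widehat X_t=\sum_{i=1}^N\widehat\alpha_{i,t}\widehat X_t^{(i)}$ for $1\le t\le T$, where, for a learning rate $\eta>0$ and with the convention that an empty sum is zero (so $\widehat\alpha_{i,1}=1/N$): Strategy 1 (gradient-based weights), defined recursively in $t$: $$\widehat\alpha_{i,t}=\frac{\exp\big(-2\eta\sum_{s=1}^{t-1}(\sum_{j=1}^N\widehat\alpha_{j,s}\widehat X_s^{(j)}-X_s)\widehat X_s^{(i)}\big)}{\sum_{k=1}^N\exp\big(-2\eta\sum_{s=1}^{t-1}(\sum_{j=1}^N\widehat\alpha_{j,s}\widehat X_s^{(j)}-X_s)\widehat X_s^{(k)}\big)}.$$ Strategy 2 (quadratic-loss weights): $$\widehat\alpha_{i,t}=\frac{\exp\big(-\eta\sum_{s=1}^{t-1}(\widehat X_s^{(i)}-X_s)^2\big)}{\sum_{k=1}^N\exp\big(-\eta\sum_{s=1}^{t-1}(\widehat X_s^{(k)}-X_s)^2\big)}.$$ *)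

theory Defs
  imports "HOL-Probability.Probability"
begin

text \<open>
  Time is \<open>int\<close> for the processes; the forecasting rounds \<open>1, ..., T\<close> and the predictor labels
  \<open>1, ..., N\<close> are of type \<open>nat\<close>. Suprema, series of nonnegative terms and expectations of
  nonnegative variables live in \<open>ennreal\<close>, so that they are always meaningful, possibly infinite.
\<close>

definition A_star :: "(int \<Rightarrow> int \<Rightarrow> real) \<Rightarrow> ennreal" where
  "A_star A = (SUP t. \<Sum>\<^sub>\<infinity>j. ennreal (A t j))"

definition a_star :: "(int \<Rightarrow> int \<Rightarrow> real) \<Rightarrow> ennreal" where
  "a_star A = (SUP j. SUP t. ennreal (A t j))"

text \<open>The value \<open>L 0\<close> is never used: sequences \<open>L\<close> are indexed by \<open>s \<ge> 1\<close>.\<close>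

definition L_star :: "(nat \<Rightarrow> real) \<Rightarrow> ennreal" where
  "L_star L = (\<Sum>\<^sub>\<infinity>s\<in>{1..}. ennreal (L s))"

definition sublinear_process ::
  "'a measure \<Rightarrow> (int \<Rightarrow> int \<Rightarrow> real) \<Rightarrow> (int \<Rightarrow> 'a \<Rightarrow> real) \<Rightarrow> (int \<Rightarrow> 'a \<Rightarrow> real) \<Rightarrow> bool"
where
  "sublinear_process M A Z X \<longleftrightarrow>
     (\<forall>t. AE \<omega> in M. ennreal \<bar>X t \<omega>\<bar> \<le> (\<Sum>\<^sub>\<infinity>j. ennreal (A t j * Z (t - j) \<omega>)))"

definition predictor :: "'a measure \<Rightarrow> (int \<Rightarrow> 'a \<Rightarrow> real) \<Rightarrow> int \<Rightarrow> ('a \<Rightarrow> real) \<Rightarrow> bool" where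
  "predictor M X t Y \<longleftrightarrow>
     (\<exists>g \<in> borel_measurable (\<Pi>\<^sub>M s\<in>{..t - 1}. (borel :: real measure)).
        \<forall>\<omega>\<in>space M. Y \<omega> = g (\<lambda>s\<in>{..t - 1}. X s \<omega>))"

definition Lipschitz_predictor ::
  "'a measure \<Rightarrow> (int \<Rightarrow> 'a \<Rightarrow> real) \<Rightarrow> (nat \<Rightarrow> real) \<Rightarrow> int \<Rightarrow> ('a \<Rightarrow> real) \<Rightarrow> bool"
where
  "Lipschitz_predictor M X L t Y \<longleftrightarrow>
     predictor M X t Y \<and>
     (AE \<omega> in M. ennreal \<bar>Y \<omega>\<bar> \<le> (\<Sum>\<^sub>\<infinity>s\<in>{1..}. ennreal (L s * \<bar>X (t - int s) \<omega>\<bar>)))"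

definition prob_simplex :: "nat \<Rightarrow> (nat \<Rightarrow> real) set" where
  "prob_simplex N = {\<nu> \<in> {1..N} \<rightarrow>\<^sub>E {0..}. (\<Sum>i=1..N. \<nu> i) = 1}"

definition convex_predictor ::
  "nat \<Rightarrow> (nat \<Rightarrow> real) \<Rightarrow> (nat \<Rightarrow> nat \<Rightarrow> 'a \<Rightarrow> real) \<Rightarrow> nat \<Rightarrow> 'a \<Rightarrow> real"
where
  "convex_predictor N \<nu> Xh t \<omega> = (\<Sum>i=1..N. \<nu> i * Xh i t \<omega>)"

text \<open>
  The weights are computed path by path: \<open>xh i s\<close> is the realised value of the \<open>i\<close>-th predictor
  and \<open>x s\<close> the observation at round \<open>s\<close>; the last two arguments are the label and the round.
\<close>

function grad_weight ::
  "real \<Rightarrow> nat \<Rightarrow> (nat \<Rightarrow> nat \<Rightarrow> real) \<Rightarrow> (nat \<Rightarrow> real) \<Rightarrow> nat \<Rightarrow> nat \<Rightarrow> real"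
where
  "grad_weight \<eta> N xh x i t =
     exp (- 2 * \<eta> * (\<Sum>s\<in>{1..<t}.
       ((\<Sum>j=1..N. grad_weight \<eta> N xh x j s * xh j s) - x s) * xh i s)) /
     (\<Sum>k=1..N. exp (- 2 * \<eta> * (\<Sum>s\<in>{1..<t}.
       ((\<Sum>j=1..N. grad_weight \<eta> N xh x j s * xh j s) - x s) * xh k s)))"
  by pat_completeness auto
termination
  by (relation "Wellfounded.measure (\<lambda>(\<eta>, N, xh, x, i, t). t)") auto

declare grad_weight.simps [simp del]

definition quad_weight ::
  "real \<Rightarrow> nat \<Rightarrow> (nat \<Rightarrow> nat \<Rightarrow> real) \<Rightarrow> (nat \<Rightarrow> real) \<Rightarrow> nat \<Rightarrow> nat \<Rightarrow> real"
where
  "quad_weight \<eta> N xh x i t =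
     exp (- \<eta> * (\<Sum>s\<in>{1..<t}. (xh i s - x s)\<^sup>2)) /
     (\<Sum>k=1..N. exp (- \<eta> * (\<Sum>s\<in>{1..<t}. (xh k s - x s)\<^sup>2)))"

definition grad_aggregate ::
  "real \<Rightarrow> nat \<Rightarrow> (int \<Rightarrow> 'a \<Rightarrow> real) \<Rightarrow> (nat \<Rightarrow> nat \<Rightarrow> 'a \<Rightarrow> real) \<Rightarrow> nat \<Rightarrow> 'a \<Rightarrow> real"
where
  "grad_aggregate \<eta> N X Xh t \<omega> =
     (\<Sum>i=1..N. grad_weight \<eta> N (\<lambda>j s. Xh j s \<omega>) (\<lambda>s. X (int s) \<omega>) i t * Xh i t \<omega>)"

definition quad_aggregate ::
  "real \<Rightarrow> nat \<Rightarrow> (int \<Rightarrow> 'a \<Rightarrow> real) \<Rightarrow> (nat \<Rightarrow> nat \<Rightarrow> 'a \<Rightarrow> real) \<Rightarrow> nat \<Rightarrow> 'a \<Rightarrow> real"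
where
  "quad_aggregate \<eta> N X Xh t \<omega> =
     (\<Sum>i=1..N. quad_weight \<eta> N (\<lambda>j s. Xh j s \<omega>) (\<lambda>s. X (int s) \<omega>) i t * Xh i t \<omega>)"

definition mean_risk ::
  "'a measure \<Rightarrow> nat \<Rightarrow> (int \<Rightarrow> 'a \<Rightarrow> real) \<Rightarrow> (nat \<Rightarrow> 'a \<Rightarrow> real) \<Rightarrow> ennreal"
where
  "mean_risk M T X Y =
     ennreal (1 / real T) * (\<Sum>t=1..T. \<integral>\<^sup>+\<omega>. ennreal ((Y t \<omega> - X (int t) \<omega>)\<^sup>2) \<partial>M)"

end

theory Submission
  imports Defs
begin

text \<open>
  Both strategies are exponential weights for some losses. If, in every round, the mixture of
  the factors \<open>exp (- \<eta> * loss)\<close> is at most \<open>exp (- \<eta> * a)\<close>, then the total of the \<open>a\<close>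
  exceeds the total loss of any fixed predictor by at most \<open>ln N / \<eta>\<close>. For the linearised
  losses such an \<open>a\<close> comes from Hoeffding's lemma, with an error \<open>2 * \<eta> * y ^ 4\<close>; for the quadratic
  losses it comes from the concavity of \<open>exp (- \<eta> * u\<^sup>2)\<close> on \<open>u\<^sup>2 \<le> 1 / (2 * \<eta>)\<close>, with an
  error \<open>max 0 (y\<^sup>2 - 1 / (2 * \<eta>))\<close>, where \<open>y\<close> bounds \<open>\<bar>prediction\<bar> + \<bar>observation\<bar>\<close>.
  By sub-linearity and the Lipschitz property, \<open>y\<close> can be taken as one series
  \<open>\<Sum>k. c k * Z k\<close> with nonnegative coefficients of total at most \<open>A_star * (1 + L_star)\<close> and each at
  most \<open>a_star * (1 + L_star)\<close>. Its moments are bounded by convexity, and its exponential moments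
  by independence.
\<close>

section \<open>Regret of exponential weights\<close>

text \<open>Common form of both strategies: \<open>quad_weight\<close> arises from squared errors,
  \<open>grad_weight\<close> from losses that contain the weights of the same round. The loss table
  is therefore arbitrary and may itself depend on the weights.\<close>

definition hedge_weight :: "real \<Rightarrow> nat \<Rightarrow> (nat \<Rightarrow> nat \<Rightarrow> real) \<Rightarrow> nat \<Rightarrow> nat \<Rightarrow> real" where
  "hedge_weight \<eta> N l i t =
     exp (- \<eta> * (\<Sum>s\<in>{1..<t}. l i s)) / (\<Sum>k=1..N. exp (- \<eta> * (\<Sum>s\<in>{1..<t}. l k s)))"

lemma hedge_weight_nonneg: "0 \<le> hedge_weight \<eta> N l i t"
  unfolding hedge_weight_def by (intro divide_nonneg_nonneg sum_nonneg) auto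

lemma sum_hedge_weight: "N \<ge> 1 \<Longrightarrow> (\<Sum>i=1..N. hedge_weight \<eta> N l i t) = 1"
proof -
  assume "N \<ge> 1"
  hence "(\<Sum>k=1..N. exp (- \<eta> * (\<Sum>s\<in>{1..<t}. l k s))) > 0"
    by (intro sum_pos) auto
  thus ?thesis by (simp add: hedge_weight_def flip: sum_divide_distrib)
qed

text \<open>The potential \<open>W\<close> is the normaliser of the weights; each round divides it by at least
  \<open>exp (\<eta> * a t)\<close>.\<close>

lemma hedge_regret:
  fixes l :: "nat \<Rightarrow> nat \<Rightarrow> real" and a :: "nat \<Rightarrow> real"
  assumes "\<eta> > 0" "i \<in> {1..N}"
    and step: "\<And>t. t \<in> {1..T} \<Longrightarrow>
      (\<Sum>k=1..N. hedge_weight \<eta> N l k t * exp (- \<eta> * l k t)) \<le> exp (- \<eta> * a t)"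
  shows "(\<Sum>t=1..T. a t) \<le> (\<Sum>t=1..T. l i t) + ln (real N) / \<eta>"
proof -
  define W where "W t = (\<Sum>k=1..N. exp (- \<eta> * (\<Sum>s\<in>{1..<t}. l k s)))" for t
  have W_pos: "W t > 0" for t
    unfolding W_def using assms(2) by (intro sum_pos) auto
  \<comment> \<open>Multiplying by the normaliser cancels the denominators of the weights. The
    condition \<open>t \<ge> 1\<close> makes \<open>{1..<Suc t}\<close> one index longer than
    \<open>{1..<t}\<close>.\<close>
  have W_Suc: "W (Suc t) = W t * (\<Sum>k=1..N. hedge_weight \<eta> N l k t * exp (- \<eta> * l k t))"
    if "t \<ge> 1" for t
  proof -
    have "exp (- \<eta> * (\<Sum>s\<in>{1..<Suc t}. l k s)) = W t * (hedge_weight \<eta> N l k t * exp (- \<eta> * l k t))" for k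
      using W_pos[of t] that
      unfolding hedge_weight_def W_def[symmetric]
      by (simp add: algebra_simps flip: exp_add)
    thus ?thesis by (subst W_def) (simp add: sum_distrib_left)
  qed
  have "W (Suc t) \<le> real N * exp (- \<eta> * (\<Sum>s=1..t. a s))" if "t \<le> T" for t
    using that
  proof (induction t)
    case 0
    show ?case by (simp add: W_def)
  next
    case (Suc t)
    have "W (Suc (Suc t)) \<le> W (Suc t) * exp (- \<eta> * a (Suc t))"
      using Suc.prems W_pos[of "Suc t"] step[of "Suc t"] W_Suc[of "Suc t"] by simp
    also have "\<dots> \<le> real N * exp (- \<eta> * (\<Sum>s=1..t. a s)) * exp (- \<eta> * a (Suc t))"
      using Suc by (intro mult_right_mono) auto
    also have "\<dots> = real N * exp (- \<eta> * (\<Sum>s=1..Suc t. a s))"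
      by (simp add: algebra_simps flip: exp_add)
    finally show ?case .
  qed
  from this[of T] have "W (Suc T) \<le> real N * exp (- \<eta> * (\<Sum>s=1..T. a s))" by simp
  \<comment> \<open>The last normaliser is at least its \<open>i\<close>-th term; comparing this
    with the upper bound and taking logarithms leaves the regret.\<close>
  moreover have "exp (- \<eta> * (\<Sum>s=1..T. l i s)) \<le> W (Suc T)"
    unfolding W_def atLeastLessThanSuc_atLeastAtMost
    by (rule member_le_sum[OF assms(2)]) auto
  ultimately have "exp (- \<eta> * (\<Sum>s=1..T. l i s)) \<le> real N * exp (- \<eta> * (\<Sum>s=1..T. a s))"
    by simp
  hence "- \<eta> * (\<Sum>s=1..T. l i s) \<le> ln (real N * exp (- \<eta> * (\<Sum>s=1..T. a s)))"
    using assms(2) by (subst ln_ge_iff) auto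
  also have "\<dots> = ln (real N) - \<eta> * (\<Sum>s=1..T. a s)"
    using assms(2) by (subst ln_mult_pos) auto
  finally show ?thesis
    using \<open>\<eta> > 0\<close> by (simp add: field_simps)
qed

section \<open>Mixtures of exponential factors within one round\<close>

text \<open>The second derivative carries the sign of \<open>2 * \<eta> * u\<^sup>2 - 1\<close>,
  which is nonpositive precisely on this interval; the convexity criterion is applied to the negated
  function.\<close>

lemma concave_on_exp_neg_square:
  assumes "\<eta> > 0"
  shows "concave_on {- sqrt (1 / (2 * \<eta>))..sqrt (1 / (2 * \<eta>))} (\<lambda>u::real. exp (- \<eta> * u\<^sup>2))"
proof -
  have "convex_on {- sqrt (1 / (2 * \<eta>))..sqrt (1 / (2 * \<eta>))} (\<lambda>u::real. - exp (- \<eta> * u\<^sup>2))"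
  proof (rule f''_ge0_imp_convex[where f' = "\<lambda>u. 2 * \<eta> * u * exp (- \<eta> * u\<^sup>2)"
        and f'' = "\<lambda>u. 2 * \<eta> * (1 - 2 * \<eta> * u\<^sup>2) * exp (- \<eta> * u\<^sup>2)"])
    fix u :: real
    assume u: "u \<in> {- sqrt (1 / (2 * \<eta>))..sqrt (1 / (2 * \<eta>))}"
    show "((\<lambda>u. - exp (- \<eta> * u\<^sup>2)) has_real_derivative 2 * \<eta> * u * exp (- \<eta> * u\<^sup>2)) (at u)"
      by (auto intro!: derivative_eq_intros)
    show "((\<lambda>u. 2 * \<eta> * u * exp (- \<eta> * u\<^sup>2)) has_real_derivative
        2 * \<eta> * (1 - 2 * \<eta> * u\<^sup>2) * exp (- \<eta> * u\<^sup>2)) (at u)"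
      by (auto intro!: derivative_eq_intros simp: algebra_simps power2_eq_square)
    have "\<bar>u\<bar> \<le> sqrt (1 / (2 * \<eta>))" using u by auto
    hence "u\<^sup>2 \<le> 1 / (2 * \<eta>)"
      using assms real_sqrt_le_iff[of "u\<^sup>2"] by (simp del: real_sqrt_le_iff)
    thus "2 * \<eta> * (1 - 2 * \<eta> * u\<^sup>2) * exp (- \<eta> * u\<^sup>2) \<ge> 0"
      using assms by (simp add: field_simps)
  qed simp
  thus ?thesis by (simp add: concave_on_def)
qed

text \<open>Outside the interval where \<open>exp (- \<eta> * u\<^sup>2)\<close> is concave, the \<open>u i\<close> are truncated to it.
  Truncation increases the left-hand side, and moves the square of the mean by at most
  \<open>y\<^sup>2 - 1 / (2 * \<eta>)\<close>.\<close>

lemma exp_neg_square_mix: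
  fixes w u :: "nat \<Rightarrow> real"
  assumes "\<eta> > 0" "finite I" and w: "\<And>i. i \<in> I \<Longrightarrow> 0 \<le> w i" "(\<Sum>i\<in>I. w i) = 1"
    and u: "\<And>i. i \<in> I \<Longrightarrow> \<bar>u i\<bar> \<le> y"
  shows "(\<Sum>i\<in>I. w i * exp (- \<eta> * (u i)\<^sup>2))
    \<le> exp (- \<eta> * ((\<Sum>i\<in>I. w i * u i)\<^sup>2 - max 0 (y\<^sup>2 - 1 / (2 * \<eta>))))"
proof -
  define c where "c = sqrt (1 / (2 * \<eta>))"
  have c: "c > 0" "c\<^sup>2 = 1 / (2 * \<eta>)" using assms(1) by (auto simp: c_def)
  define v where "v i = max (- c) (min c (u i))" for i
  have ne: "I \<noteq> {}" using w(2) by auto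
  have "v i \<in> {-c..c}" for i using c by (auto simp: v_def)
  hence mix: "(\<Sum>i\<in>I. w i * exp (- \<eta> * (v i)\<^sup>2)) \<le> exp (- \<eta> * (\<Sum>i\<in>I. w i *\<^sub>R v i)\<^sup>2)"
    using convex_on_sum[OF assms(2) ne
        concave_on_exp_neg_square[OF assms(1), unfolded concave_on_def, folded c_def] w(2) w(1), of v]
    by (simp add: sum_negf)
  have "(v i)\<^sup>2 \<le> (u i)\<^sup>2" for i
    using c by (subst abs_le_square_iff[symmetric]) (auto simp: v_def)
  hence le: "(\<Sum>i\<in>I. w i * exp (- \<eta> * (u i)\<^sup>2)) \<le> (\<Sum>i\<in>I. w i * exp (- \<eta> * (v i)\<^sup>2))"
    using w(1) assms(1) by (intro sum_mono mult_left_mono) auto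
  have "(\<Sum>i\<in>I. w i * u i)\<^sup>2 - (\<Sum>i\<in>I. w i * v i)\<^sup>2 \<le> max 0 (y\<^sup>2 - c\<^sup>2)"
  proof (cases "y \<le> c")
    case True
    hence "v i = u i" if "i \<in> I" for i using u[OF that] by (auto simp: v_def)
    thus ?thesis by simp
  next
    case False
    \<comment> \<open>Each truncation now moves \<open>u i\<close> by at most \<open>y - c\<close>,
      while \<open>u i + v i\<close> is at most \<open>y + c\<close> in absolute value. The
      difference of the squared means factors into the means of \<open>u - v\<close> and of
      \<open>u + v\<close>, which gives \<open>y\<^sup>2 - c\<^sup>2\<close>.\<close>
    have "\<bar>u i - v i\<bar> \<le> y - c" if "i \<in> I" for i using u[OF that] False c by (auto simp: v_def)
    hence "\<bar>\<Sum>i\<in>I. w i * (u i - v i)\<bar> \<le> (\<Sum>i\<in>I. w i * (y - c))"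
      using w(1) by (intro order_trans[OF sum_abs] sum_mono) (auto simp: abs_mult intro!: mult_left_mono)
    moreover have "\<bar>u i + v i\<bar> \<le> y + c" if "i \<in> I" for i
      using u[OF that] False c by (auto simp: v_def)
    hence "\<bar>\<Sum>i\<in>I. w i * (u i + v i)\<bar> \<le> (\<Sum>i\<in>I. w i * (y + c))"
      using w(1) by (intro order_trans[OF sum_abs] sum_mono) (auto simp: abs_mult intro!: mult_left_mono)
    ultimately have "\<bar>\<Sum>i\<in>I. w i * (u i - v i)\<bar> * \<bar>\<Sum>i\<in>I. w i * (u i + v i)\<bar> \<le> (y - c) * (y + c)"
      using w(2) False c(1) by (intro mult_mono) (auto simp flip: sum_distrib_right)
    hence "(\<Sum>i\<in>I. w i * (u i - v i)) * (\<Sum>i\<in>I. w i * (u i + v i)) \<le> (y - c) * (y + c)"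
      by (simp flip: abs_mult)
    thus ?thesis
      by (simp add: algebra_simps sum.distrib sum_subtractf power2_eq_square)
  qed
  hence "exp (- \<eta> * (\<Sum>i\<in>I. w i * v i)\<^sup>2)
      \<le> exp (- \<eta> * ((\<Sum>i\<in>I. w i * u i)\<^sup>2 - max 0 (y\<^sup>2 - 1 / (2 * \<eta>))))"
    using assms(1) by (simp add: c(2) del: max_def)
  with mix le show ?thesis unfolding real_scaleR_def by linarith
qed

text \<open>Rescaling the losses to \<open>u i\<close> in [0, 1] and replacing \<open>exp\<close> by
  its chord reduces the mixture to a two-point law with mean \<open>p\<close>, to which Hoeffding's
  bound with \<open>h\<^sup>2 / 8\<close> applies. With \<open>h = 2 * \<eta> * r\<close> this is
  the error \<open>\<eta>\<^sup>2 * r\<^sup>2 / 2\<close> in the exponent.\<close>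

lemma Hoeffding_mix:
  fixes w l :: "nat \<Rightarrow> real"
  assumes "\<eta> > 0" "finite I" and w: "\<And>i. i \<in> I \<Longrightarrow> 0 \<le> w i" "(\<Sum>i\<in>I. w i) = 1"
    and l: "\<And>i. i \<in> I \<Longrightarrow> \<bar>l i\<bar> \<le> r"
  shows "(\<Sum>i\<in>I. w i * exp (- \<eta> * l i)) \<le> exp (- \<eta> * ((\<Sum>i\<in>I. w i * l i) - \<eta> * r\<^sup>2 / 2))"
proof (cases "r > 0")
  case False
  have "l i = 0" if "i \<in> I" for i using l[OF that] False by auto
  thus ?thesis using w assms(1) by simp
next
  case r: True
  define h where "h = 2 * \<eta> * r"
  \<comment> \<open>The rescaling reverses the order of the losses, so that the slope
    \<open>h\<close> in the exponent is positive.\<close>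
  define u where "u i = (r - l i) / (2 * r)" for i
  define p where "p = (\<Sum>i\<in>I. w i * u i)"
  have u: "0 \<le> u i" "u i \<le> 1" if "i \<in> I" for i
    using l[OF that] r by (auto simp: u_def field_simps)
  have "h > 0" using r assms(1) by (simp add: h_def)
  have "p \<ge> 0" unfolding p_def using w(1) u(1) by (intro sum_nonneg) auto
  have l_eq: "- \<eta> * l i = - \<eta> * r + h * u i" for i
    using r by (simp add: u_def h_def field_simps)
  have chord: "exp (h * u i) \<le> 1 + u i * (exp h - 1)" if "i \<in> I" for i
    using convex_onD[OF exp_convex, of "u i" 0 h] u[OF that] by (simp add: algebra_simps)
  have "(\<Sum>i\<in>I. w i * exp (- \<eta> * l i)) = exp (- \<eta> * r) * (\<Sum>i\<in>I. w i * exp (h * u i))"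
    unfolding l_eq exp_add by (simp add: sum_distrib_left mult_ac)
  also have "\<dots> \<le> exp (- \<eta> * r) * (\<Sum>i\<in>I. w i * (1 + u i * (exp h - 1)))"
    using w(1) chord by (intro mult_left_mono sum_mono) auto
  also have "(\<Sum>i\<in>I. w i * (1 + u i * (exp h - 1))) = 1 + p * (exp h - 1)"
    using w(2) by (simp add: p_def algebra_simps sum.distrib sum_subtractf sum_distrib_left)
  also have "1 + p * (exp h - 1) \<le> exp (h * p + h\<^sup>2 / 8)"
  proof -
    have "1 + p * (exp h - 1) > 0" using \<open>p \<ge> 0\<close> \<open>h > 0\<close> by (intro add_pos_nonneg) auto
    moreover have "ln (1 + p * (exp h - 1)) \<le> h * p + h\<^sup>2 / 8"
      using Hoeffdings_lemma_aux[of h p] \<open>p \<ge> 0\<close> \<open>h > 0\<close> by simp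
    ultimately show ?thesis by (metis exp_le_cancel_iff exp_ln)
  qed
  also have "exp (- \<eta> * r) * exp (h * p + h\<^sup>2 / 8) = exp (- \<eta> * ((\<Sum>i\<in>I. w i * l i) - \<eta> * r\<^sup>2 / 2))"
  proof -
    have "2 * r * p = (\<Sum>i\<in>I. w i * (2 * r * u i))"
      by (simp add: p_def sum_distrib_left mult_ac)
    also have "\<dots> = (\<Sum>i\<in>I. w i * (r - l i))" using r by (simp add: u_def)
    also have "\<dots> = r - (\<Sum>i\<in>I. w i * l i)"
      using w(2) by (simp add: algebra_simps sum_subtractf flip: sum_distrib_left)
    finally have "\<eta> * (2 * r * p) = \<eta> * (r - (\<Sum>i\<in>I. w i * l i))" by simp
    hence "h * p = \<eta> * r - \<eta> * (\<Sum>i\<in>I. w i * l i)"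
      by (simp add: h_def right_diff_distrib)
    thus ?thesis
      by (simp add: h_def power_mult_distrib algebra_simps power2_eq_square flip: exp_add)
  qed
  finally show ?thesis by simp
qed

section \<open>Pathwise regret of the two strategies\<close>

text \<open>Because the weights sum to one, the error of the aggregate is the weighted mean of the
  errors; the single-round mixture bound then feeds the general regret bound.\<close>

lemma quad_weight_regret:
  fixes xh :: "nat \<Rightarrow> nat \<Rightarrow> real" and x y :: "nat \<Rightarrow> real"
  assumes "\<eta> > 0" "i \<in> {1..N}"
    and y: "\<And>j t. j \<in> {1..N} \<Longrightarrow> t \<in> {1..T} \<Longrightarrow> \<bar>xh j t - x t\<bar> \<le> y t"
  shows "(\<Sum>t=1..T. ((\<Sum>j=1..N. quad_weight \<eta> N xh x j t * xh j t) - x t)\<^sup>2)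
    \<le> (\<Sum>t=1..T. (xh i t - x t)\<^sup>2) + ln (real N) / \<eta> + (\<Sum>t=1..T. max 0 ((y t)\<^sup>2 - 1 / (2 * \<eta>)))"
proof -
  define l where "l j t = (xh j t - x t)\<^sup>2" for j t
  define w where "w = hedge_weight \<eta> N l"
  have quad: "quad_weight \<eta> N xh x = w"
    by (intro ext) (simp add: w_def quad_weight_def hedge_weight_def l_def)
  have sum_w: "(\<Sum>j=1..N. w j t) = 1" for t
    unfolding w_def using assms(2) by (intro sum_hedge_weight) auto
  have w_nonneg: "0 \<le> w j t" for j t
    unfolding w_def by (rule hedge_weight_nonneg)
  have "(\<Sum>t=1..T. ((\<Sum>j=1..N. w j t * xh j t) - x t)\<^sup>2 - max 0 ((y t)\<^sup>2 - 1 / (2 * \<eta>)))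
    \<le> (\<Sum>t=1..T. l i t) + ln (real N) / \<eta>"
  proof (rule hedge_regret[OF assms(1,2)])
    fix t assume t: "t \<in> {1..T}"
    have eq: "(\<Sum>j=1..N. w j t * (xh j t - x t)) = (\<Sum>j=1..N. w j t * xh j t) - x t"
      using sum_w[of t] by (simp add: right_diff_distrib sum_subtractf flip: sum_distrib_right)
    show "(\<Sum>k=1..N. hedge_weight \<eta> N l k t * exp (- \<eta> * l k t))
      \<le> exp (- \<eta> * (((\<Sum>j=1..N. w j t * xh j t) - x t)\<^sup>2 - max 0 ((y t)\<^sup>2 - 1 / (2 * \<eta>))))"
      using exp_neg_square_mix[OF assms(1), of "{1..N}" "\<lambda>j. w j t" "\<lambda>j. xh j t - x t" "y t"]
        w_nonneg sum_w y[OF _ t]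
      unfolding eq by (simp add: l_def w_def)
  qed
  thus ?thesis by (simp add: quad l_def sum_subtractf)
qed

text \<open>The squared loss is linearised at the aggregate \<open>f t\<close>. Linear losses let
  the regret against single predictors average into a regret against every mixture, and convexity of
  the square returns to squared errors.\<close>

lemma grad_weight_regret:
  fixes xh :: "nat \<Rightarrow> nat \<Rightarrow> real" and x y \<nu> :: "nat \<Rightarrow> real"
  assumes "\<eta> > 0" "N \<ge> 1" and \<nu>: "\<And>i. i \<in> {1..N} \<Longrightarrow> 0 \<le> \<nu> i" "(\<Sum>i=1..N. \<nu> i) = 1"
    and y: "\<And>j t. j \<in> {1..N} \<Longrightarrow> t \<in> {1..T} \<Longrightarrow> \<bar>xh j t\<bar> + \<bar>x t\<bar> \<le> y t"
  shows "(\<Sum>t=1..T. ((\<Sum>j=1..N. grad_weight \<eta> N xh x j t * xh j t) - x t)\<^sup>2)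
    \<le> (\<Sum>t=1..T. ((\<Sum>j=1..N. \<nu> j * xh j t) - x t)\<^sup>2) + ln (real N) / \<eta> + (\<Sum>t=1..T. 2 * \<eta> * y t ^ 4)"
proof -
  define w where "w = grad_weight \<eta> N xh x"
  define f where "f t = (\<Sum>j=1..N. w j t * xh j t)" for t
  define g where "g t = (\<Sum>j=1..N. \<nu> j * xh j t)" for t
  define l where "l j t = 2 * (f t - x t) * xh j t" for j t
  have w: "w = hedge_weight \<eta> N l"
  proof (intro ext)
    fix i t
    have "- 2 * \<eta> * (\<Sum>s\<in>{1..<t}. (f s - x s) * xh j s) = - \<eta> * (\<Sum>s\<in>{1..<t}. l j s)" for j
      by (simp add: l_def sum_distrib_left mult_ac)
    note eq = this[unfolded f_def w_def]
    \<comment> \<open>The recursion is unfolded exactly once, on the left: the losses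
      \<open>l\<close> already contain the same weights, so both sides are the same
      quotient.\<close>
    show "w i t = hedge_weight \<eta> N l i t"
      unfolding w_def hedge_weight_def
      by (subst grad_weight.simps) (simp only: eq)
  qed
  have sum_w: "(\<Sum>j=1..N. w j t) = 1" for t
    unfolding w using assms(2) by (intro sum_hedge_weight) auto
  have w_nonneg: "0 \<le> w j t" for j t
    unfolding w by (rule hedge_weight_nonneg)
  have mix_l: "(\<Sum>j=1..N. v j * l j t) = 2 * (f t - x t) * (\<Sum>j=1..N. v j * xh j t)" for v t
    unfolding l_def sum_distrib_left by (simp add: mult_ac)
  have regret: "(\<Sum>t=1..T. (\<Sum>j=1..N. w j t * l j t) - 2 * \<eta> * y t ^ 4)
      \<le> (\<Sum>t=1..T. l i t) + ln (real N) / \<eta>" if i: "i \<in> {1..N}" for i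
  proof (rule hedge_regret[OF assms(1) i])
    fix t assume t: "t \<in> {1..T}"
    have xh: "\<bar>xh j t\<bar> \<le> y t - \<bar>x t\<bar>" if "j \<in> {1..N}" for j
      using y[OF that t] by simp
    have "\<bar>f t\<bar> \<le> (\<Sum>j=1..N. w j t * (y t - \<bar>x t\<bar>))"
      unfolding f_def using w_nonneg xh
      by (intro order_trans[OF sum_abs] sum_mono) (auto simp: abs_mult intro!: mult_left_mono)
    hence "\<bar>f t - x t\<bar> \<le> y t"
      using sum_w[of t] by (simp flip: sum_distrib_right)
    \<comment> \<open>Both factors are bounded by \<open>y t\<close>, so the linear losses have
      radius \<open>2 * (y t * y t)\<close> and Hoeffding's error becomes
      \<open>2 * \<eta> * y t ^ 4\<close>.\<close>
    hence "\<bar>f t - x t\<bar> * \<bar>xh j t\<bar> \<le> y t * y t" if "j \<in> {1..N}" for j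
      using y[OF that t] by (intro mult_mono) auto
    hence "\<bar>l j t\<bar> \<le> 2 * (y t * y t)" if "j \<in> {1..N}" for j
      using that unfolding l_def abs_mult by force
    hence "(\<Sum>k=1..N. w k t * exp (- \<eta> * l k t))
      \<le> exp (- \<eta> * ((\<Sum>j=1..N. w j t * l j t) - \<eta> * (2 * (y t * y t))\<^sup>2 / 2))"
      using w_nonneg sum_w by (intro Hoeffding_mix assms(1)) auto
    also have "\<eta> * (2 * (y t * y t))\<^sup>2 / 2 = 2 * \<eta> * y t ^ 4"
      by (simp add: power2_eq_square power4_eq_xxxx)
    finally show "(\<Sum>k=1..N. hedge_weight \<eta> N l k t * exp (- \<eta> * l k t))
      \<le> exp (- \<eta> * ((\<Sum>j=1..N. w j t * l j t) - 2 * \<eta> * y t ^ 4))"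
      by (simp add: w)
  qed
  \<comment> \<open>The bounds against single predictors are averaged with the weights
    \<open>\<nu>\<close>; what does not depend on \<open>i\<close> is kept because
    \<open>\<nu>\<close> has total one.\<close>
  have "(\<Sum>t=1..T. (\<Sum>j=1..N. w j t * l j t) - 2 * \<eta> * y t ^ 4) - ln (real N) / \<eta>
      = (\<Sum>i=1..N. \<nu> i * ((\<Sum>t=1..T. (\<Sum>j=1..N. w j t * l j t) - 2 * \<eta> * y t ^ 4) - ln (real N) / \<eta>))"
    using \<nu>(2) by (simp flip: sum_distrib_right)
  also have "\<dots> \<le> (\<Sum>i=1..N. \<nu> i * (\<Sum>t=1..T. l i t))"
    using regret \<nu>(1) by (intro sum_mono mult_left_mono) (auto simp: algebra_simps)
  also have "\<dots> = (\<Sum>t=1..T. \<Sum>i=1..N. \<nu> i * l i t)"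
    unfolding sum_distrib_left by (rule sum.swap)
  also have "\<dots> = (\<Sum>t=1..T. 2 * (f t - x t) * g t)"
    by (simp only: mix_l g_def)
  finally have "(\<Sum>t=1..T. 2 * (f t - x t) * f t - 2 * \<eta> * y t ^ 4) - ln (real N) / \<eta>
      \<le> (\<Sum>t=1..T. 2 * (f t - x t) * g t)"
    by (simp only: mix_l f_def)
  \<comment> \<open>Tangent-line inequality for the square at the aggregate; the gap is exactly
    \<open>(f t - g t)\<^sup>2\<close>.\<close>
  moreover have "(\<Sum>t=1..T. (f t - x t)\<^sup>2)
      \<le> (\<Sum>t=1..T. (g t - x t)\<^sup>2 + (2 * (f t - x t) * f t - 2 * (f t - x t) * g t))"
  proof (rule sum_mono)
    fix t
    have "0 \<le> (f t - g t)\<^sup>2" by simp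
    thus "(f t - x t)\<^sup>2 \<le> (g t - x t)\<^sup>2 + (2 * (f t - x t) * f t - 2 * (f t - x t) * g t)"
      by (simp add: power2_eq_square algebra_simps)
  qed
  ultimately show ?thesis
    unfolding w_def[symmetric] f_def[symmetric] g_def[symmetric] sum.distrib sum_subtractf by linarith
qed

section \<open>Moments of weighted series\<close>

lemma suminf_eq_infsum_ennreal: "(\<Sum>n. f n) = infsum (f :: nat \<Rightarrow> ennreal) UNIV"
proof -
  have "(f has_sum infsum f UNIV) UNIV"
    by (intro has_sum_infsum nonneg_summable_on_complete) auto
  thus ?thesis by (metis has_sum_imp_sums sums_unique)
qed

text \<open>The definitions speak of \<open>infsum\<close>, while exchange of summations is obtained
  from Fubini for \<open>nn_integral\<close>. The identity is proved on the naturals, where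
  \<open>infsum\<close> is an ordinary series, and transported along \<open>to_nat\<close>.\<close>

lemma infsum_eq_nn_integral_count_space:
  fixes f :: "'i::countable \<Rightarrow> ennreal"
  shows "infsum f A = (\<integral>\<^sup>+k. f k \<partial>count_space A)"
proof -
  define B where "B = to_nat ` A"
  define g where "g n = f (from_nat n)" for n
  have "infsum f A = infsum (g \<circ> to_nat) A" by (simp add: g_def o_def)
  also have "\<dots> = infsum g B"
    unfolding B_def by (subst infsum_reindex) auto
  also have "\<dots> = infsum (\<lambda>n. g n * indicator B n) UNIV"
    by (intro infsum_cong_neutral) auto
  also have "\<dots> = (\<integral>\<^sup>+n. g n * indicator B n \<partial>count_space UNIV)"
    by (simp add: nn_integral_count_space_nat suminf_eq_infsum_ennreal)
  also have "\<dots> = (\<integral>\<^sup>+n. g n \<partial>count_space B)"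
    by (cases "B = UNIV") (simp_all add: nn_integral_count_space_indicator)
  also have "\<dots> = (\<integral>\<^sup>+k. g (to_nat k) \<partial>count_space A)"
    by (intro nn_integral_bij_count_space[symmetric]) (auto simp: B_def bij_betw_def)
  finally show ?thesis by (simp add: g_def)
qed

lemma nn_integral_count_space_swap:
  fixes f :: "'i::countable \<Rightarrow> 'j::countable \<Rightarrow> ennreal"
  shows "(\<integral>\<^sup>+i. \<integral>\<^sup>+j. f i j \<partial>count_space B \<partial>count_space A) = (\<integral>\<^sup>+j. \<integral>\<^sup>+i. f i j \<partial>count_space A \<partial>count_space B)"
proof -
  interpret pair_sigma_finite "count_space A" "count_space B"
    by (intro pair_sigma_finite.intro sigma_finite_measure_count_space_countable) auto
  show ?thesis
    using Fubini'[of "\<lambda>i j. f i j"] by (simp add: pair_measure_countable)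
qed

text \<open>Enumerating the integers gives partial sums indexed by \<open>nat\<close>, which makes
  measurability and limits of random series accessible.\<close>

lemma nn_integral_count_space_int_decode:
  "(\<integral>\<^sup>+k. f k \<partial>count_space UNIV) = (\<Sum>n. f (int_decode n))"
  using nn_integral_bij_count_space[OF bij_int_decode, of f]
  by (simp add: nn_integral_count_space_nat)

section \<open>Power and exponential moments\<close>

text \<open>Jensen's inequality for the power, with weights of total at most \<open>K\<close>
  instead of one. Young's inequality at the normalised mean \<open>\<mu>\<close> replaces a tangent
  line; dividing by \<open>K\<close> rather than by the actual total gives the constant
  directly.\<close>

lemma powr_weighted_sum_le:
  fixes b z :: "'i \<Rightarrow> real"
  assumes "p > 1" and b: "\<And>k. k \<in> F \<Longrightarrow> 0 \<le> b k" and z: "\<And>k. k \<in> F \<Longrightarrow> 0 \<le> z k"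
    and K: "(\<Sum>k\<in>F. b k) \<le> K" and "finite F"
  shows "(\<Sum>k\<in>F. b k * z k) powr p \<le> K powr (p - 1) * (\<Sum>k\<in>F. b k * z k powr p)"
proof (cases "K > 0")
  case False
  hence "(\<Sum>k\<in>F. b k) = 0" using K b by (smt (verit) sum_nonneg)
  hence "b k = 0" if "k \<in> F" for k
    using b that assms(5) by (simp add: sum_nonneg_eq_0_iff)
  thus ?thesis by simp
next
  case True
  define \<mu> where "\<mu> = (\<Sum>k\<in>F. b k * z k) / K"
  define q where "q = p / (p - 1)"
  have q: "q > 1" "1 / p + 1 / q = 1" "(p - 1) * q = p"
    using assms(1) by (auto simp: q_def field_simps)
  have "\<mu> \<ge> 0" unfolding \<mu>_def using True b z by (intro divide_nonneg_pos sum_nonneg) auto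
  have Young: "z k * \<mu> powr (p - 1) \<le> z k powr p / p + \<mu> powr p / q" if "k \<in> F" for k
    using Youngs_inequality[of p q "z k" "\<mu> powr (p - 1)"] z[OF that] assms(1) q
    by (simp add: powr_powr)
  have "K * \<mu> powr p = (\<Sum>k\<in>F. b k * z k) * \<mu> powr (p - 1)"
  proof -
    have "\<mu> powr p = \<mu> * \<mu> powr (p - 1)"
      using powr_mult_base[OF \<open>\<mu> \<ge> 0\<close>, of "p - 1"] by simp
    moreover have "K * \<mu> = (\<Sum>k\<in>F. b k * z k)" using True by (simp add: \<mu>_def)
    ultimately show ?thesis by (metis mult.assoc)
  qed
  also have "\<dots> = (\<Sum>k\<in>F. b k * (z k * \<mu> powr (p - 1)))"
    by (simp only: sum_distrib_right mult.assoc)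
  also have "\<dots> \<le> (\<Sum>k\<in>F. b k * (z k powr p / p + \<mu> powr p / q))"
    using b Young by (intro sum_mono mult_left_mono) auto
  also have "\<dots> = (\<Sum>k\<in>F. b k * z k powr p) / p + (\<Sum>k\<in>F. b k) * (\<mu> powr p / q)"
    by (simp add: distrib_left sum.distrib sum_divide_distrib sum_distrib_right)
  also have "\<dots> \<le> (\<Sum>k\<in>F. b k * z k powr p) / p + K * (\<mu> powr p / q)"
    using K q by (intro add_left_mono mult_right_mono) auto
  \<comment> \<open>The last summand is absorbed on the left; as \<open>1 / p + 1 / q = 1\<close>, a
    factor \<open>1 / p\<close> remains on both sides.\<close>
  finally have "K * \<mu> powr p * (1 - 1 / q) \<le> (\<Sum>k\<in>F. b k * z k powr p) / p"
    by (simp add: algebra_simps)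
  moreover have "1 - 1 / q = 1 / p" using q(2) by simp
  ultimately have "K * \<mu> powr p \<le> (\<Sum>k\<in>F. b k * z k powr p)"
    using assms(1) by (simp add: field_simps)
  hence "K powr (p - 1) * (K * \<mu> powr p) \<le> K powr (p - 1) * (\<Sum>k\<in>F. b k * z k powr p)"
    by (intro mult_left_mono) auto
  also have "K powr (p - 1) * (K * \<mu> powr p) = (K * \<mu>) powr p"
    using powr_mult_base[of K "p - 1"] True by (simp add: powr_mult mult_ac)
  finally show ?thesis using True by (simp add: \<mu>_def)
qed

context prob_space
begin

text \<open>Exchanging sum and integral bounds the expectation of the series by \<open>m\<close>
  times the total of \<open>c\<close>; a variable of finite expectation is almost surely
  finite.\<close>

lemma AE_weighted_series_finite:
  fixes Z :: "int \<Rightarrow> 'a \<Rightarrow> real" and c :: "int \<Rightarrow> real"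
  assumes [measurable]: "\<And>k. Z k \<in> borel_measurable M"
    and "\<And>k. 0 \<le> c k" and c: "(\<integral>\<^sup>+k. ennreal (c k) \<partial>count_space UNIV) < \<infinity>"
    and m: "\<And>k. (\<integral>\<^sup>+\<omega>. ennreal (Z k \<omega>) \<partial>M) \<le> m" "m < \<infinity>"
  shows "AE \<omega> in M. (\<integral>\<^sup>+k. ennreal (c k * Z k \<omega>) \<partial>count_space UNIV) \<noteq> \<infinity>"
proof -
  have "(\<integral>\<^sup>+\<omega>. (\<Sum>n. ennreal (c (int_decode n) * Z (int_decode n) \<omega>)) \<partial>M)
    = (\<Sum>n. \<integral>\<^sup>+\<omega>. ennreal (c (int_decode n) * Z (int_decode n) \<omega>) \<partial>M)"
    by (intro nn_integral_suminf) auto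
  \<comment> \<open>\<open>ennreal\<close> sends negative numbers to zero, so a nonnegative factor
    may be split off whatever the sign of \<open>Z\<close>.\<close>
  also have "\<dots> = (\<Sum>n. ennreal (c (int_decode n)) * (\<integral>\<^sup>+\<omega>. ennreal (Z (int_decode n) \<omega>) \<partial>M))"
    using assms(2) by (simp add: ennreal_mult' nn_integral_cmult)
  also have "\<dots> \<le> (\<Sum>n. ennreal (c (int_decode n)) * m)"
    by (intro suminf_le mult_left_mono m) auto
  also have "\<dots> = (\<integral>\<^sup>+k. ennreal (c k) \<partial>count_space UNIV) * m"
    by (simp add: ennreal_suminf_multc nn_integral_count_space_int_decode)
  also have "\<dots> < \<infinity>" using c m(2) by (simp add: ennreal_mult_less_top)
  finally show ?thesis
    unfolding nn_integral_count_space_int_decode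
    by (intro nn_integral_noteq_infinite) auto
qed

text \<open>Fatou's lemma carries a bound valid for all finite subsums over to the full series. It
  serves both the power and the exponential function.\<close>

lemma nn_integral_weighted_series_le:
  fixes Z :: "int \<Rightarrow> 'a \<Rightarrow> real" and c :: "int \<Rightarrow> real" and h :: "real \<Rightarrow> real"
  assumes [measurable]: "\<And>k. Z k \<in> borel_measurable M" "h \<in> borel_measurable borel"
    and Z: "AE \<omega> in M. \<forall>k. 0 \<le> Z k \<omega>" and "\<And>k. 0 \<le> c k"
    and fin: "AE \<omega> in M. (\<integral>\<^sup>+k. ennreal (c k * Z k \<omega>) \<partial>count_space UNIV) \<noteq> \<infinity>"
    and h: "continuous_on {0..} h"
    and D: "\<And>F. finite F \<Longrightarrow> (\<integral>\<^sup>+\<omega>. ennreal (h (\<Sum>k\<in>F. c k * Z k \<omega>)) \<partial>M) \<le> D"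
  shows "(\<integral>\<^sup>+\<omega>. ennreal (h (enn2real (\<integral>\<^sup>+k. ennreal (c k * Z k \<omega>) \<partial>count_space UNIV))) \<partial>M) \<le> D"
proof -
  define s where "s n \<omega> = (\<Sum>i<n. c (int_decode i) * Z (int_decode i) \<omega>)" for n \<omega>
  define Y where "Y \<omega> = enn2real (\<integral>\<^sup>+k. ennreal (c k * Z k \<omega>) \<partial>count_space UNIV)" for \<omega>
  have [measurable]: "s n \<in> borel_measurable M" for n unfolding s_def by measurable
  have "(\<integral>\<^sup>+\<omega>. ennreal (h (Y \<omega>)) \<partial>M) \<le> (\<integral>\<^sup>+\<omega>. liminf (\<lambda>n. ennreal (h (s n \<omega>))) \<partial>M)"
  proof (intro nn_integral_mono_AE)
    show "AE \<omega> in M. ennreal (h (Y \<omega>)) \<le> liminf (\<lambda>n. ennreal (h (s n \<omega>)))"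
      using Z fin
    proof eventually_elim
      case (elim \<omega>)
      define a where "a n = c (int_decode n) * Z (int_decode n) \<omega>" for n
      have a: "0 \<le> a n" for n using elim(1) assms(4) by (simp add: a_def)
      have ne: "(\<Sum>n. ennreal (a n)) \<noteq> top"
        using elim(2) by (simp add: nn_integral_count_space_int_decode a_def)
      have "Y \<omega> = (\<Sum>n. a n)"
        unfolding Y_def nn_integral_count_space_int_decode a_def[symmetric]
        using suminf_ennreal[OF a ne] a summable_suminf_not_top[OF a ne] by (simp add: suminf_nonneg)
      hence "(\<lambda>n. s n \<omega>) \<longlonglongrightarrow> Y \<omega>"
        using summable_LIMSEQ[OF summable_suminf_not_top[OF a ne]] by (simp add: s_def a_def)
      \<comment> \<open>Nonnegative partial sums stay in \<open>{0..}\<close>, the set on which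
        \<open>h\<close> is continuous.\<close>
      moreover have "0 \<le> s n \<omega>" for n
        unfolding s_def a_def[symmetric] by (intro sum_nonneg a)
      ultimately have "(\<lambda>n. h (s n \<omega>)) \<longlonglongrightarrow> h (Y \<omega>)"
        using continuous_on_tendsto_compose[OF h, of "\<lambda>n. s n \<omega>" "Y \<omega>"] by (simp add: Y_def)
      hence "liminf (\<lambda>n. ennreal (h (s n \<omega>))) = ennreal (h (Y \<omega>))"
        by (intro lim_imp_Liminf tendsto_ennrealI) auto
      thus ?case by simp
    qed
  qed
  also have "\<dots> \<le> liminf (\<lambda>n. \<integral>\<^sup>+\<omega>. ennreal (h (s n \<omega>)) \<partial>M)"
    by (intro nn_integral_liminf) measurable
  also have "\<dots> \<le> liminf (\<lambda>n::nat. D)"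
  proof (intro Liminf_mono always_eventually allI)
    fix n
    have "s n \<omega> = (\<Sum>k\<in>int_decode ` {..<n}. c k * Z k \<omega>)" for \<omega>
      unfolding s_def by (subst sum.reindex) (auto simp: inj_int_decode)
    thus "(\<integral>\<^sup>+\<omega>. ennreal (h (s n \<omega>)) \<partial>M) \<le> D" using D by simp
  qed
  also have "\<dots> = D" by (simp add: Liminf_const)
  finally show ?thesis by (simp add: Y_def)
qed

lemma nn_integral_powr_weighted_sum_le:
  fixes Z :: "int \<Rightarrow> 'a \<Rightarrow> real" and c :: "int \<Rightarrow> real"
  assumes [measurable]: "\<And>k. Z k \<in> borel_measurable M"
    and Z: "AE \<omega> in M. \<forall>k. 0 \<le> Z k \<omega>" and c: "\<And>k. 0 \<le> c k"
    and "p > 1" "finite F" and K: "(\<Sum>k\<in>F. c k) \<le> K"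
    and m: "\<And>k. (\<integral>\<^sup>+\<omega>. ennreal (Z k \<omega> powr p) \<partial>M) \<le> ennreal m" "0 \<le> m"
  shows "(\<integral>\<^sup>+\<omega>. ennreal ((\<Sum>k\<in>F. c k * Z k \<omega>) powr p) \<partial>M) \<le> ennreal (K powr p * m)"
proof -
  have "0 \<le> K" using K c by (meson order_trans sum_nonneg)
  have "(\<integral>\<^sup>+\<omega>. ennreal ((\<Sum>k\<in>F. c k * Z k \<omega>) powr p) \<partial>M)
      \<le> (\<integral>\<^sup>+\<omega>. ennreal (K powr (p - 1)) * (\<Sum>k\<in>F. ennreal (c k) * ennreal (Z k \<omega> powr p)) \<partial>M)"
  proof (intro nn_integral_mono_AE)
    show "AE \<omega> in M. ennreal ((\<Sum>k\<in>F. c k * Z k \<omega>) powr p)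
      \<le> ennreal (K powr (p - 1)) * (\<Sum>k\<in>F. ennreal (c k) * ennreal (Z k \<omega> powr p))"
      using Z
    proof eventually_elim
      case (elim \<omega>)
      have "ennreal ((\<Sum>k\<in>F. c k * Z k \<omega>) powr p)
          \<le> ennreal (K powr (p - 1) * (\<Sum>k\<in>F. c k * Z k \<omega> powr p))"
        using elim c K assms(4,5) by (intro ennreal_leI powr_weighted_sum_le) auto
      also have "\<dots> = ennreal (K powr (p - 1)) * (\<Sum>k\<in>F. ennreal (c k) * ennreal (Z k \<omega> powr p))"
        using c by (simp add: sum_nonneg flip: ennreal_mult)
      finally show ?case .
    qed
  qed
  also have "\<dots> = ennreal (K powr (p - 1)) * (\<Sum>k\<in>F. ennreal (c k) * (\<integral>\<^sup>+\<omega>. ennreal (Z k \<omega> powr p) \<partial>M))"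
    by (simp add: nn_integral_cmult nn_integral_sum)
  also have "\<dots> \<le> ennreal (K powr (p - 1)) * (\<Sum>k\<in>F. ennreal (c k) * ennreal m)"
    by (intro mult_left_mono sum_mono m) auto
  also have "\<dots> = ennreal (K powr (p - 1) * ((\<Sum>k\<in>F. c k) * m))"
    unfolding sum_distrib_right using c m(2) by (simp add: sum_nonneg flip: ennreal_mult)
  also have "\<dots> \<le> ennreal (K powr (p - 1) * (K * m))"
    using K m(2) by (intro ennreal_leI mult_left_mono mult_right_mono) auto
  also have "K powr (p - 1) * (K * m) = K powr p * m"
    using powr_mult_base[OF \<open>0 \<le> K\<close>, of "p - 1"] by (simp add: mult_ac)
  finally show ?thesis .
qed

text \<open>Jensen's inequality for the concave power \<open>s / \<zeta>\<close>, written as the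
  weighted arithmetic-geometric mean inequality for \<open>exp (\<zeta> * u) / \<phi>\<close> and 1.
  Normalising by \<open>\<phi>\<close> allows an upper bound in place of the exact moment.\<close>

lemma nn_integral_exp_power_le:
  fixes U :: "'a \<Rightarrow> real"
  assumes [measurable]: "U \<in> borel_measurable M"
    and "\<zeta> > 0" "0 \<le> s" "s \<le> \<zeta>" and \<phi>: "(\<integral>\<^sup>+\<omega>. ennreal (exp (\<zeta> * U \<omega>)) \<partial>M) \<le> ennreal \<phi>" "\<phi> > 0"
  shows "(\<integral>\<^sup>+\<omega>. ennreal (exp (s * U \<omega>)) \<partial>M) \<le> ennreal (\<phi> powr (s / \<zeta>))"
proof -
  define \<theta> where "\<theta> = s / \<zeta>"
  have \<theta>: "0 \<le> \<theta>" "0 \<le> 1 - \<theta>" using assms by (auto simp: \<theta>_def)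
  have "exp (s * u) \<le> \<phi> powr \<theta> * (\<theta> / \<phi> * exp (\<zeta> * u) + (1 - \<theta>))" for u
  proof -
    have "exp (s * u) = \<phi> powr \<theta> * ((exp (\<zeta> * u) / \<phi>) powr \<theta> * 1 powr (1 - \<theta>))"
      using assms by (simp add: powr_divide) (simp add: \<theta>_def powr_def)
    also have "\<dots> \<le> \<phi> powr \<theta> * (\<theta> * (exp (\<zeta> * u) / \<phi>) + (1 - \<theta>) * 1)"
      using \<theta> \<phi>(2) by (intro mult_left_mono Youngs_inequality_0) auto
    finally show ?thesis by simp
  qed
  hence "(\<integral>\<^sup>+\<omega>. ennreal (exp (s * U \<omega>)) \<partial>M)
      \<le> (\<integral>\<^sup>+\<omega>. ennreal (\<phi> powr \<theta>) * (ennreal (\<theta> / \<phi>) * ennreal (exp (\<zeta> * U \<omega>)) + ennreal (1 - \<theta>)) \<partial>M)"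
    using \<theta> \<phi>(2) by (intro nn_integral_mono) (simp flip: ennreal_mult ennreal_plus)
  also have "\<dots> = ennreal (\<phi> powr \<theta>) * (ennreal (\<theta> / \<phi>) * (\<integral>\<^sup>+\<omega>. ennreal (exp (\<zeta> * U \<omega>)) \<partial>M) + ennreal (1 - \<theta>))"
    by (simp add: nn_integral_cmult nn_integral_add emeasure_space_1)
  also have "\<dots> \<le> ennreal (\<phi> powr \<theta>) * (ennreal (\<theta> / \<phi>) * ennreal \<phi> + ennreal (1 - \<theta>))"
    by (intro mult_left_mono add_right_mono \<phi>) auto
  also have "\<dots> = ennreal (\<phi> powr \<theta>)"
    using \<theta> \<phi>(2) by (simp flip: ennreal_mult ennreal_plus)
  finally show ?thesis by (simp add: \<theta>_def)
qed

text \<open>Independence turns the exponential of the sum into a product. In the \<open>k\<close>-th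
  factor the exponent \<open>s * c k\<close> is at most \<open>\<zeta>\<close>, so each factor
  contributes a power of \<open>\<phi>\<close>, and the exponents add up.\<close>

lemma nn_integral_exp_weighted_sum_le:
  fixes Z :: "int \<Rightarrow> 'a \<Rightarrow> real" and c :: "int \<Rightarrow> real"
  assumes indep: "indep_vars (\<lambda>_. borel) Z UNIV" and c: "\<And>k. 0 \<le> c k" "\<And>k. s * c k \<le> \<zeta>"
    and "\<zeta> > 0" "s \<ge> 0" "finite F" and K: "(\<Sum>k\<in>F. c k) \<le> K"
    and \<phi>: "\<And>k. (\<integral>\<^sup>+\<omega>. ennreal (exp (\<zeta> * Z k \<omega>)) \<partial>M) \<le> ennreal \<phi>" "\<phi> \<ge> 1"
  shows "(\<integral>\<^sup>+\<omega>. ennreal (exp (s * (\<Sum>k\<in>F. c k * Z k \<omega>))) \<partial>M) \<le> ennreal (\<phi> powr (s * K / \<zeta>))"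
proof -
  have [measurable]: "Z k \<in> borel_measurable M" for k
    using indep by (auto simp: indep_vars_def)
  have "indep_vars (\<lambda>_. borel) (\<lambda>k \<omega>. ennreal (exp (s * c k * Z k \<omega>))) F"
    by (rule indep_vars_compose2[OF indep_vars_subset[OF indep]]) auto
  hence "(\<integral>\<^sup>+\<omega>. (\<Prod>k\<in>F. ennreal (exp (s * c k * Z k \<omega>))) \<partial>M)
      = (\<Prod>k\<in>F. \<integral>\<^sup>+\<omega>. ennreal (exp (s * c k * Z k \<omega>)) \<partial>M)"
    using assms(6) by (intro indep_vars_nn_integral) auto
  also have "\<dots> \<le> (\<Prod>k\<in>F. ennreal (\<phi> powr (s * c k / \<zeta>)))"
    using assms by (intro prod_mono_ennreal nn_integral_exp_power_le) auto
  also have "\<dots> = ennreal (\<phi> powr (\<Sum>k\<in>F. s * c k / \<zeta>))"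
    using \<phi>(2) by (simp add: prod_ennreal powr_sum assms(6))
  \<comment> \<open>As \<open>\<phi> \<ge> 1\<close>, its powers increase with the exponent, so the
    total of the coefficients may be replaced by \<open>K\<close>.\<close>
  also have "\<dots> \<le> ennreal (\<phi> powr (s * K / \<zeta>))"
    using assms by (intro ennreal_leI powr_mono)
      (auto simp flip: sum_divide_distrib sum_distrib_left intro!: divide_right_mono mult_left_mono)
  finally show ?thesis
    by (simp add: prod_ennreal exp_sum assms(6) sum_distrib_left mult.assoc)
qed

end

section \<open>The envelope of the process and its predictors\<close>

text \<open>The coefficient of \<open>Z k\<close> in the bound for \<open>\<bar>X t\<bar> + (\<Sum>s. L s * \<bar>X (t - s)\<bar>)\<close>.\<close>

definition envelope_coeff :: "(int \<Rightarrow> int \<Rightarrow> real) \<Rightarrow> (nat \<Rightarrow> real) \<Rightarrow> int \<Rightarrow> int \<Rightarrow> ennreal" where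
  "envelope_coeff A L t k = ennreal (A t (t - k)) +
     (\<integral>\<^sup>+s. ennreal (L s) * ennreal (A (t - int s) (t - int s - k)) \<partial>count_space {1..})"

lemma L_star_eq: "L_star L = (\<integral>\<^sup>+s. ennreal (L s) \<partial>count_space {1..})"
  unfolding L_star_def by (rule infsum_eq_nn_integral_count_space)

lemma bij_diff_int: "bij (\<lambda>k. t - k :: int)"
  by (rule bij_betwI[where g = "\<lambda>k. t - k"]) auto

lemma nn_integral_le_A_star: "(\<integral>\<^sup>+k. ennreal (A t (t - k)) \<partial>count_space UNIV) \<le> A_star A"
proof -
  have "(\<integral>\<^sup>+k. ennreal (A t (t - k)) \<partial>count_space UNIV) = (\<Sum>\<^sub>\<infinity>j. ennreal (A t j))"
    using nn_integral_bij_count_space[OF bij_diff_int[of t], of "\<lambda>j. ennreal (A t j)"]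
    by (simp add: infsum_eq_nn_integral_count_space)
  also have "\<dots> \<le> A_star A" unfolding A_star_def by (rule SUP_upper) simp
  finally show ?thesis .
qed

text \<open>After exchanging the two summations, every inner sum over \<open>k\<close> is a row of
  \<open>A\<close>, hence at most \<open>A_star\<close>; the rows are weighted by 1 and by the
  \<open>L s\<close>.\<close>

lemma nn_integral_envelope_coeff_le:
  "(\<integral>\<^sup>+k. envelope_coeff A L t k \<partial>count_space UNIV) \<le> A_star A * (1 + L_star L)"
proof -
  have "(\<integral>\<^sup>+k. envelope_coeff A L t k \<partial>count_space UNIV)
    = (\<integral>\<^sup>+k. ennreal (A t (t - k)) \<partial>count_space UNIV)
      + (\<integral>\<^sup>+s. \<integral>\<^sup>+k. ennreal (L s) * ennreal (A (t - int s) (t - int s - k)) \<partial>count_space UNIV \<partial>count_space {1..})"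
    unfolding envelope_coeff_def
    by (subst nn_integral_add) (auto intro: nn_integral_count_space_swap)
  also have "\<dots> \<le> A_star A + (\<integral>\<^sup>+s. ennreal (L s) * A_star A \<partial>count_space {1..})"
    by (intro add_mono nn_integral_le_A_star nn_integral_mono)
      (auto simp: nn_integral_cmult intro!: mult_left_mono nn_integral_le_A_star)
  also have "\<dots> = A_star A * (1 + L_star L)"
    by (subst nn_integral_multc) (auto simp: L_star_eq distrib_left mult.commute)
  finally show ?thesis .
qed

lemma A_le_a_star: "ennreal (A t j) \<le> a_star A"
  unfolding a_star_def by (intro SUP_upper2[of j] SUP_upper2[of t]) auto

lemma a_star_le_A_star: "a_star A \<le> A_star A"
  unfolding a_star_def
proof (intro SUP_least)
  fix j t :: int
  have "ennreal (A t j) \<le> (\<integral>\<^sup>+j. ennreal (A t j) \<partial>count_space UNIV)"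
    by (rule nn_integral_ge_point) simp
  also have "\<dots> \<le> A_star A"
    unfolding A_star_def infsum_eq_nn_integral_count_space by (rule SUP_upper) simp
  finally show "ennreal (A t j) \<le> A_star A" .
qed

text \<open>The same split entry by entry, with \<open>a_star\<close> bounding single coefficients
  instead of \<open>A_star\<close> bounding rows. This uniform bound limits the admissible exponents
  in the exponential case.\<close>

lemma envelope_coeff_le: "envelope_coeff A L t k \<le> a_star A * (L_star L + 1)"
proof -
  have "envelope_coeff A L t k \<le> a_star A + (\<integral>\<^sup>+s. ennreal (L s) * a_star A \<partial>count_space {1..})"
    unfolding envelope_coeff_def
    by (intro add_mono A_le_a_star nn_integral_mono mult_left_mono) auto
  also have "\<dots> = a_star A * (L_star L + 1)"
    by (subst nn_integral_multc) (auto simp: L_star_eq distrib_left mult.commute add.commute)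
  finally show ?thesis .
qed

text \<open>Stated for one path: the sub-linear bound is inserted for the present and every lagged
  value, and Tonelli collects the coefficient of each \<open>z k\<close>.\<close>

lemma envelope_ge:
  fixes x z :: "int \<Rightarrow> real"
  assumes "\<And>t j. 0 \<le> A t j" and L: "\<And>s. s \<ge> 1 \<Longrightarrow> 0 \<le> L s"
    and x: "\<And>t. ennreal \<bar>x t\<bar> \<le> (\<Sum>\<^sub>\<infinity>j. ennreal (A t j * z (t - j)))"
  shows "ennreal \<bar>x t\<bar> + (\<Sum>\<^sub>\<infinity>s\<in>{1..}. ennreal (L s * \<bar>x (t - int s)\<bar>))
    \<le> (\<integral>\<^sup>+k. envelope_coeff A L t k * ennreal (z k) \<partial>count_space UNIV)"
proof -
  have x': "ennreal \<bar>x t\<bar> \<le> (\<integral>\<^sup>+k. ennreal (A t (t - k)) * ennreal (z k) \<partial>count_space UNIV)" for t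
    using x[of t] nn_integral_bij_count_space[OF bij_diff_int[of t], of "\<lambda>j. ennreal (A t j * z (t - j))"]
    by (simp add: infsum_eq_nn_integral_count_space ennreal_mult' assms(1))
  have "(\<Sum>\<^sub>\<infinity>s\<in>{1..}. ennreal (L s * \<bar>x (t - int s)\<bar>))
      = (\<integral>\<^sup>+s. ennreal (L s) * ennreal \<bar>x (t - int s)\<bar> \<partial>count_space {1..})"
    unfolding infsum_eq_nn_integral_count_space
    using L by (intro nn_integral_cong) (auto simp: ennreal_mult')
  also have "\<dots> \<le> (\<integral>\<^sup>+s. ennreal (L s) *
      (\<integral>\<^sup>+k. ennreal (A (t - int s) (t - int s - k)) * ennreal (z k) \<partial>count_space UNIV) \<partial>count_space {1..})"
    by (intro nn_integral_mono mult_left_mono x') auto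
  also have "\<dots> = (\<integral>\<^sup>+s. \<integral>\<^sup>+k. ennreal (L s) *
      ennreal (A (t - int s) (t - int s - k)) * ennreal (z k) \<partial>count_space UNIV \<partial>count_space {1..})"
    by (simp add: nn_integral_cmult mult.assoc)
  also have "\<dots> = (\<integral>\<^sup>+k. (\<integral>\<^sup>+s. ennreal (L s) *
      ennreal (A (t - int s) (t - int s - k)) \<partial>count_space {1..}) * ennreal (z k) \<partial>count_space UNIV)"
    by (subst nn_integral_count_space_swap) (simp add: nn_integral_multc)
  finally have "ennreal \<bar>x t\<bar> + (\<Sum>\<^sub>\<infinity>s\<in>{1..}. ennreal (L s * \<bar>x (t - int s)\<bar>))
    \<le> (\<integral>\<^sup>+k. ennreal (A t (t - k)) * ennreal (z k) \<partial>count_space UNIV) + \<dots>"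
    by (intro add_mono x')
  also have "\<dots> = (\<integral>\<^sup>+k. envelope_coeff A L t k * ennreal (z k) \<partial>count_space UNIV)"
    unfolding envelope_coeff_def distrib_right by (subst nn_integral_add) auto
  finally show ?thesis .
qed

section \<open>Measurability of predictors, weights and aggregates\<close>

lemma borel_measurable_predictor:
  assumes "predictor M X t Y" and [measurable]: "\<And>t. X t \<in> borel_measurable M"
  shows "Y \<in> borel_measurable M"
proof -
  obtain g where [measurable]: "g \<in> borel_measurable (\<Pi>\<^sub>M s\<in>{..t - 1}. (borel :: real measure))"
    and Y: "\<And>\<omega>. \<omega> \<in> space M \<Longrightarrow> Y \<omega> = g (\<lambda>s\<in>{..t - 1}. X s \<omega>)"
    using assms(1) unfolding predictor_def by auto
  have "(\<lambda>\<omega>. g (\<lambda>s\<in>{..t - 1}. X s \<omega>)) \<in> borel_measurable M" by measurable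
  thus ?thesis using Y by (simp cong: measurable_cong)
qed

text \<open>Strong induction on the round, following the recursion: the weights of round
  \<open>t\<close> involve those of all earlier rounds.\<close>

lemma borel_measurable_grad_weight:
  assumes [measurable]: "\<And>t. X t \<in> borel_measurable M"
    and Xh[measurable]: "\<And>i t. i \<in> {1..N} \<Longrightarrow> t \<in> {1..T} \<Longrightarrow> Xh i t \<in> borel_measurable M"
    and "t \<le> T" "i \<in> {1..N}"
  shows "(\<lambda>\<omega>. grad_weight \<eta> N (\<lambda>j s. Xh j s \<omega>) (\<lambda>s. X (int s) \<omega>) i t) \<in> borel_measurable M"
  using assms(3,4)
proof (induction t arbitrary: i rule: less_induct)
  case (less t)
  have [measurable]: "(\<lambda>\<omega>. grad_weight \<eta> N (\<lambda>j s. Xh j s \<omega>) (\<lambda>s. X (int s) \<omega>) j s) \<in> borel_measurable M"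
    if "j \<in> {1..N}" "s \<in> {1..<t}" for j s
    using less that by auto
  have [measurable]: "Xh j s \<in> borel_measurable M" if "j \<in> {1..N}" "s \<in> {1..<t}" for j s
    using Xh[of j s] less.prems that by auto
  have [measurable]: "i \<in> {1..N}" by fact
  show ?case
    by (subst grad_weight.simps) measurable
qed

lemma borel_measurable_grad_aggregate:
  assumes "\<And>t. X t \<in> borel_measurable M"
    and "\<And>i t. i \<in> {1..N} \<Longrightarrow> t \<in> {1..T} \<Longrightarrow> Xh i t \<in> borel_measurable M"
    and "t \<in> {1..T}"
  shows "grad_aggregate \<eta> N X Xh t \<in> borel_measurable M"
  unfolding grad_aggregate_def[abs_def]
  using assms by (intro borel_measurable_sum borel_measurable_times
      borel_measurable_grad_weight[where T = T]) auto

lemma borel_measurable_quad_aggregate: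
  assumes [measurable]: "\<And>t. X t \<in> borel_measurable M"
    and Xh: "\<And>i t. i \<in> {1..N} \<Longrightarrow> t \<in> {1..T} \<Longrightarrow> Xh i t \<in> borel_measurable M"
    and t: "t \<in> {1..T}"
  shows "quad_aggregate \<eta> N X Xh t \<in> borel_measurable M"
proof -
  have [measurable]: "Xh j s \<in> borel_measurable M" if "j \<in> {1..N}" "s \<in> {1..<t}" for j s
    using Xh[of j s] t that by auto
  have [measurable]: "Xh j t \<in> borel_measurable M" if "j \<in> {1..N}" for j
    using Xh[of j t] t that by auto
  show ?thesis
    unfolding quad_aggregate_def[abs_def] quad_weight_def by measurable
qed

section \<open>From pathwise regret to risk\<close>

text \<open>The regret bound is integrated: the remainder \<open>r\<close> enters once for all
  rounds and the errors \<open>R t\<close> once per round, so division by \<open>T\<close> gives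
  \<open>r / real T + D\<close>.\<close>

lemma mean_risk_le:
  fixes Y Y' R :: "nat \<Rightarrow> 'a \<Rightarrow> real"
  assumes "T \<ge> 1" and [measurable]: "\<And>t. X t \<in> borel_measurable M"
    and Y: "\<And>t. t \<in> {1..T} \<Longrightarrow> Y t \<in> borel_measurable M"
    and Y': "\<And>t. t \<in> {1..T} \<Longrightarrow> Y' t \<in> borel_measurable M"
    and R: "\<And>t. t \<in> {1..T} \<Longrightarrow> R t \<in> borel_measurable M"
    and le: "AE \<omega> in M. (\<Sum>t=1..T. (Y t \<omega> - X (int t) \<omega>)\<^sup>2)
      \<le> (\<Sum>t=1..T. (Y' t \<omega> - X (int t) \<omega>)\<^sup>2) + r + (\<Sum>t=1..T. R t \<omega>)"
    and R_nonneg: "\<And>t \<omega>. 0 \<le> R t \<omega>" and "0 \<le> r" "0 \<le> D"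
    and D: "\<And>t. (\<integral>\<^sup>+\<omega>. ennreal (R t \<omega>) \<partial>M) \<le> ennreal D" and "prob_space M"
  shows "mean_risk M T X Y \<le> mean_risk M T X Y' + ennreal (r / real T + D)"
proof -
  interpret prob_space M by fact
  note [measurable] = Y Y' R
  have "(\<Sum>t=1..T. \<integral>\<^sup>+\<omega>. ennreal ((Y t \<omega> - X (int t) \<omega>)\<^sup>2) \<partial>M)
      = (\<integral>\<^sup>+\<omega>. ennreal (\<Sum>t=1..T. (Y t \<omega> - X (int t) \<omega>)\<^sup>2) \<partial>M)"
    by (subst nn_integral_sum[symmetric]) auto
  also have "\<dots> \<le> (\<integral>\<^sup>+\<omega>. (\<Sum>t=1..T. ennreal ((Y' t \<omega> - X (int t) \<omega>)\<^sup>2)) + ennreal r + (\<Sum>t=1..T. ennreal (R t \<omega>)) \<partial>M)"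
    using R_nonneg \<open>0 \<le> r\<close>
    by (intro nn_integral_mono_AE eventually_mono[OF le])
      (auto simp: sum_nonneg simp flip: ennreal_plus intro!: ennreal_leI)
  also have "\<dots> = (\<Sum>t=1..T. \<integral>\<^sup>+\<omega>. ennreal ((Y' t \<omega> - X (int t) \<omega>)\<^sup>2) \<partial>M) + ennreal r
      + (\<Sum>t=1..T. \<integral>\<^sup>+\<omega>. ennreal (R t \<omega>) \<partial>M)"
  proof -
    have "(\<integral>\<^sup>+\<omega>. (\<Sum>t=1..T. ennreal ((Y' t \<omega> - X (int t) \<omega>)\<^sup>2)) \<partial>M)
        = (\<Sum>t=1..T. \<integral>\<^sup>+\<omega>. ennreal ((Y' t \<omega> - X (int t) \<omega>)\<^sup>2) \<partial>M)"
      by (rule nn_integral_sum) measurable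
    moreover have "(\<integral>\<^sup>+\<omega>. (\<Sum>t=1..T. ennreal (R t \<omega>)) \<partial>M) = (\<Sum>t=1..T. \<integral>\<^sup>+\<omega>. ennreal (R t \<omega>) \<partial>M)"
      by (rule nn_integral_sum) measurable
    ultimately show ?thesis
      by (subst nn_integral_add, measurable, measurable, subst nn_integral_add, measurable, measurable)
        (simp add: emeasure_space_1)
  qed
  also have "\<dots> \<le> (\<Sum>t=1..T. \<integral>\<^sup>+\<omega>. ennreal ((Y' t \<omega> - X (int t) \<omega>)\<^sup>2) \<partial>M) + ennreal r
      + (\<Sum>t=1..T. ennreal D)"
    by (intro add_left_mono sum_mono D)
  also have "\<dots> = (\<Sum>t=1..T. \<integral>\<^sup>+\<omega>. ennreal ((Y' t \<omega> - X (int t) \<omega>)\<^sup>2) \<partial>M) + ennreal (r + real T * D)"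
    using \<open>0 \<le> r\<close> \<open>0 \<le> D\<close> by (simp add: add.assoc ennreal_mult' flip: ennreal_of_nat_eq_real_of_nat)
  finally have "mean_risk M T X Y \<le> ennreal (1 / real T) *
      ((\<Sum>t=1..T. \<integral>\<^sup>+\<omega>. ennreal ((Y' t \<omega> - X (int t) \<omega>)\<^sup>2) \<partial>M) + ennreal (r + real T * D))"
    unfolding mean_risk_def by (rule mult_left_mono) simp
  also have "\<dots> = mean_risk M T X Y' + ennreal (1 / real T * (r + real T * D))"
    using \<open>0 \<le> r\<close> \<open>0 \<le> D\<close> by (simp add: mean_risk_def distrib_left flip: ennreal_mult)
  also have "1 / real T * (r + real T * D) = r / real T + D"
    using assms(1) by (simp add: field_simps)
  finally show ?thesis .
qed

section \<open>Bounds for the truncation error\<close>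

text \<open>When the excess is positive, \<open>2 * \<eta> * y\<^sup>2\<close> exceeds one, so
  multiplying \<open>y\<^sup>2\<close> by its power of order \<open>p / 2 - 1\<close> only increases
  it.\<close>

lemma excess_le_powr:
  fixes \<eta> p y :: real
  assumes "\<eta> > 0" "p > 2" "y \<ge> 0"
  shows "max 0 (y\<^sup>2 - 1 / (2 * \<eta>)) \<le> (2 * \<eta>) powr (p / 2 - 1) * y powr p"
proof (cases "y\<^sup>2 \<le> 1 / (2 * \<eta>)")
  case True
  thus ?thesis by simp
next
  case False
  hence y: "y > 0" using assms by (cases "y = 0") auto
  have "1 \<le> 2 * \<eta> * y\<^sup>2" using False assms(1) by (simp add: field_simps)
  hence "1 \<le> (2 * \<eta> * y\<^sup>2) powr (p / 2 - 1)"
    using assms by (intro ge_one_powr_ge_zero) auto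
  hence "y\<^sup>2 * 1 \<le> y\<^sup>2 * (2 * \<eta> * y\<^sup>2) powr (p / 2 - 1)"
    by (intro mult_left_mono) auto
  also have "\<dots> = (2 * \<eta>) powr (p / 2 - 1) * (y powr 2 * (y powr 2) powr (p / 2 - 1))"
    using y by (simp add: powr_mult)
  also have "y powr 2 * (y powr 2) powr (p / 2 - 1) = y powr p"
  proof -
    have "y powr 2 * (y powr 2) powr (p / 2 - 1) = y powr (2 + 2 * (p / 2 - 1))"
      by (simp only: powr_powr powr_add)
    thus ?thesis by simp
  qed
  finally have "y\<^sup>2 \<le> (2 * \<eta>) powr (p / 2 - 1) * y powr p" by simp
  moreover have "0 < 1 / (2 * \<eta>)" using assms(1) by simp
  ultimately have "y\<^sup>2 - 1 / (2 * \<eta>) \<le> (2 * \<eta>) powr (p / 2 - 1) * y powr p" by linarith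
  thus ?thesis by simp
qed

text \<open>With the threshold \<open>c\<close> and \<open>d = s * (y - c)\<close>, the excess is
  \<open>(d\<^sup>2 + 2 * (s * c) * d) / s\<^sup>2\<close>; both monomials are bounded by multiples
  of \<open>exp (d - 1)\<close>, which yields the factors \<open>2 / exp 1\<close> and
  \<open>2 + s * c\<close>.\<close>

lemma excess_le_exp:
  fixes \<eta> s y :: real
  assumes "\<eta> > 0" "s > 0" "y \<ge> 0"
  shows "max 0 (y\<^sup>2 - 1 / (2 * \<eta>))
    \<le> 2 / exp 1 * s powr (-2) * (2 + s * (2 * \<eta>) powr (-1/2)) * exp (- s * (2 * \<eta>) powr (-1/2)) * exp (s * y)"
    (is "_ \<le> ?rhs")
proof -
  define c where "c = (2 * \<eta>) powr (-1/2)"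
  have c: "c > 0" using assms(1) by (simp add: c_def)
  have c2: "c\<^sup>2 = 1 / (2 * \<eta>)"
  proof -
    have "c\<^sup>2 = c powr 2" using c by simp
    also have "\<dots> = (2 * \<eta>) powr (-1)" unfolding c_def powr_powr by simp
    also have "\<dots> = 1 / (2 * \<eta>)"
      by (rule powr_neg_one) (use assms(1) in simp)
    finally show ?thesis .
  qed
  have rhs: "?rhs = 2 / exp 1 * s powr (-2) * (2 + s * c) * exp (- s * c) * exp (s * y)"
    by (simp add: c_def)
  show ?thesis
  proof (cases "y \<le> c")
    case True
    hence "y\<^sup>2 \<le> 1 / (2 * \<eta>)" using assms(3) c2 by (metis power_mono)
    moreover have "0 \<le> ?rhs" unfolding rhs using c assms(2) by simp
    ultimately show ?thesis by simp
  next
    case False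
    define d where "d = s * (y - c)"
    have d: "d \<ge> 0" using False assms(2) by (simp add: d_def)
    have d1: "d \<le> exp (d - 1)" using exp_ge_add_one_self[of "d - 1"] by linarith
    \<comment> \<open>The inequality \<open>v \<le> exp (v - 1)\<close> is squared at
      \<open>v = d / 2\<close>; weakening \<open>exp (d - 2)\<close> to \<open>exp (d - 1)\<close>
      gives both monomials the same exponential.\<close>
    have "d / 2 \<le> exp (d / 2 - 1)" using exp_ge_add_one_self[of "d / 2 - 1"] by linarith
    hence "(d / 2)\<^sup>2 \<le> (exp (d / 2 - 1))\<^sup>2" using d by (intro power_mono) auto
    also have "(exp (d / 2 - 1))\<^sup>2 = exp (d - 2)"
      by (simp add: power2_eq_square flip: exp_add)
    also have "\<dots> \<le> exp (d - 1)" by simp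
    finally have d2: "d\<^sup>2 \<le> 4 * exp (d - 1)" by (simp add: power_divide)
    have "s\<^sup>2 * (y\<^sup>2 - c\<^sup>2) = d\<^sup>2 + 2 * (s * c) * d"
      by (simp add: d_def power2_eq_square algebra_simps)
    also have "\<dots> \<le> 4 * exp (d - 1) + 2 * (s * c) * exp (d - 1)"
      using d1 d2 c assms(2) by (intro add_mono mult_left_mono) auto
    also have "\<dots> = 2 * (2 + s * c) * exp (d - 1)" by (simp add: algebra_simps)
    also have "exp (d - 1) = exp (- s * c) * exp (s * y) / exp 1"
    proof -
      have "d - 1 = - s * c + s * y - 1" by (simp add: d_def algebra_simps)
      thus ?thesis by (simp only: exp_add exp_diff)
    qed
    finally have "y\<^sup>2 - c\<^sup>2 \<le> 2 * (2 + s * c) * (exp (- s * c) * exp (s * y) / exp 1) / s\<^sup>2"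
      using assms(2) by (simp add: pos_le_divide_eq mult.commute)
    also have "\<dots> = ?rhs"
    proof -
      have "s powr (-2) = 1 / s\<^sup>2" using powr_minus_divide[of s 2] assms(2) by simp
      thus ?thesis unfolding rhs by (simp add: mult_ac)
    qed
    finally have "y\<^sup>2 - 1 / (2 * \<eta>) \<le> ?rhs" by (simp only: c2)
    moreover have "0 \<le> ?rhs" unfolding rhs using c assms(2) by simp
    ultimately show ?thesis by simp
  qed
qed

section \<open>Risk bounds\<close>

locale sublinear_prediction = prob_space M for M :: "'a measure" +
  fixes X Z :: "int \<Rightarrow> 'a \<Rightarrow> real"
    and A :: "int \<Rightarrow> int \<Rightarrow> real"
    and L :: "nat \<Rightarrow> real"
    and Xh :: "nat \<Rightarrow> nat \<Rightarrow> 'a \<Rightarrow> real"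
    and T N :: nat
  assumes T: "T \<ge> 1" and N: "N \<ge> 1"
    and X_borel[measurable]: "\<And>t. X t \<in> borel_measurable M"
    and Z_borel[measurable]: "\<And>t. Z t \<in> borel_measurable M"
    and Z_nonneg: "\<And>t. AE \<omega> in M. 0 \<le> Z t \<omega>"
    and A_nonneg: "\<And>t j. 0 \<le> A t j"
    and A_star_finite: "A_star A < \<infinity>"
    and sublinear: "sublinear_process M A Z X"
    and L_nonneg: "\<And>s. s \<ge> 1 \<Longrightarrow> 0 \<le> L s"
    and L_star_finite: "L_star L < \<infinity>"
    and predictors: "\<And>i t. i \<in> {1..N} \<Longrightarrow> t \<in> {1..T} \<Longrightarrow> Lipschitz_predictor M X L (int t) (Xh i t)"
begin

definition K :: real where "K = enn2real (A_star A) * (1 + enn2real (L_star L))"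

definition c :: "int \<Rightarrow> int \<Rightarrow> real" where "c t k = enn2real (envelope_coeff A L t k)"

text \<open>Real-valued so that it can enter the pathwise regret bounds. Where the series diverges
  \<open>enn2real\<close> yields 0, so domination needs almost sure finiteness.\<close>

definition envelope :: "nat \<Rightarrow> 'a \<Rightarrow> real" where
  "envelope t \<omega> = enn2real (\<integral>\<^sup>+k. ennreal (c (int t) k * Z k \<omega>) \<partial>count_space UNIV)"

lemma K_nonneg: "0 \<le> K"
  by (simp add: K_def)

lemma ennreal_K: "ennreal K = A_star A * (1 + L_star L)"
  using A_star_finite L_star_finite by (simp add: K_def ennreal_mult)

lemma c_nonneg: "0 \<le> c t k"
  by (simp add: c_def)

lemma ennreal_c: "ennreal (c t k) = envelope_coeff A L t k"
proof -
  have "envelope_coeff A L t k \<le> (\<integral>\<^sup>+k. envelope_coeff A L t k \<partial>count_space UNIV)"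
    by (rule nn_integral_ge_point) simp
  also have "\<dots> \<le> ennreal K"
    unfolding ennreal_K by (rule nn_integral_envelope_coeff_le)
  finally show ?thesis
    by (simp add: c_def le_less_trans[OF _ ennreal_less_top])
qed

lemma nn_integral_c_le: "(\<integral>\<^sup>+k. ennreal (c t k) \<partial>count_space UNIV) \<le> ennreal K"
  unfolding ennreal_c ennreal_K by (rule nn_integral_envelope_coeff_le)

lemma sum_c_le:
  assumes "finite F"
  shows "(\<Sum>k\<in>F. c t k) \<le> K"
proof -
  have "ennreal (\<Sum>k\<in>F. c t k) = (\<integral>\<^sup>+k. ennreal (c t k) \<partial>count_space F)"
    using assms by (simp add: nn_integral_count_space_finite c_nonneg)
  also have "\<dots> \<le> (\<integral>\<^sup>+k. ennreal (c t k) \<partial>count_space UNIV)"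
    by (auto simp: nn_integral_count_space_indicator indicator_def intro!: nn_integral_mono)
  also note nn_integral_c_le
  finally show ?thesis using K_nonneg by simp
qed

lemma Xh_borel[measurable]: "i \<in> {1..N} \<Longrightarrow> t \<in> {1..T} \<Longrightarrow> Xh i t \<in> borel_measurable M"
  using predictors borel_measurable_predictor[of M X, OF _ X_borel]
  unfolding Lipschitz_predictor_def by blast

lemma envelope_nonneg: "0 \<le> envelope t \<omega>"
  by (simp add: envelope_def)

lemma envelope_borel[measurable]: "envelope t \<in> borel_measurable M"
  unfolding envelope_def[abs_def] nn_integral_count_space_int_decode by measurable

lemma AE_Z_nonneg: "AE \<omega> in M. \<forall>k. 0 \<le> Z k \<omega>"
  by (simp add: AE_all_countable Z_nonneg)

text \<open>Countably many almost sure statements are merged into one null set, off which the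
  pathwise envelope inequality applies to all rounds and predictors at once.\<close>

lemma AE_predictor_le_envelope:
  assumes fin: "\<And>t. AE \<omega> in M. (\<integral>\<^sup>+k. ennreal (c t k * Z k \<omega>) \<partial>count_space UNIV) \<noteq> \<infinity>"
  shows "AE \<omega> in M. \<forall>i\<in>{1..N}. \<forall>t\<in>{1..T}. \<bar>Xh i t \<omega>\<bar> + \<bar>X (int t) \<omega>\<bar> \<le> envelope t \<omega>"
proof -
  have "AE \<omega> in M. \<forall>t. ennreal \<bar>X t \<omega>\<bar> \<le> (\<Sum>\<^sub>\<infinity>j. ennreal (A t j * Z (t - j) \<omega>))"
    using sublinear by (simp add: sublinear_process_def AE_all_countable)
  moreover have "AE \<omega> in M. \<forall>i\<in>{1..N}. \<forall>t\<in>{1..T}.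
      ennreal \<bar>Xh i t \<omega>\<bar> \<le> (\<Sum>\<^sub>\<infinity>s\<in>{1..}. ennreal (L s * \<bar>X (int t - int s) \<omega>\<bar>))"
    using predictors by (intro AE_finite_allI) (auto simp: Lipschitz_predictor_def)
  moreover have "AE \<omega> in M. \<forall>t. (\<integral>\<^sup>+k. ennreal (c t k * Z k \<omega>) \<partial>count_space UNIV) \<noteq> \<infinity>"
    using fin by (simp add: AE_all_countable)
  ultimately show ?thesis
  proof eventually_elim
    case (elim \<omega>)
    show ?case
    proof (intro ballI)
      fix i t assume it: "i \<in> {1..N}" "t \<in> {1..T}"
      have "ennreal \<bar>X (int t) \<omega>\<bar> + ennreal \<bar>Xh i t \<omega>\<bar>
          \<le> ennreal \<bar>X (int t) \<omega>\<bar> + (\<Sum>\<^sub>\<infinity>s\<in>{1..}. ennreal (L s * \<bar>X (int t - int s) \<omega>\<bar>))"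
        using elim(2) it by (intro add_left_mono) auto
      also have "\<dots> \<le> (\<integral>\<^sup>+k. envelope_coeff A L (int t) k * ennreal (Z k \<omega>) \<partial>count_space UNIV)"
        using elim(1) A_nonneg L_nonneg by (intro envelope_ge) auto
      also have "\<dots> = (\<integral>\<^sup>+k. ennreal (c (int t) k * Z k \<omega>) \<partial>count_space UNIV)"
        by (simp add: ennreal_mult' c_nonneg ennreal_c)
      also have "\<dots> = ennreal (envelope t \<omega>)"
        using elim(3) by (simp add: envelope_def less_top)
      finally have "ennreal (\<bar>X (int t) \<omega>\<bar> + \<bar>Xh i t \<omega>\<bar>) \<le> ennreal (envelope t \<omega>)"
        by (simp flip: ennreal_plus)
      thus "\<bar>Xh i t \<omega>\<bar> + \<bar>X (int t) \<omega>\<bar> \<le> envelope t \<omega>"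
        using envelope_nonneg[of t \<omega>] by (simp del: ennreal_plus)
    qed
  qed
qed

text \<open>\<open>z \<le> 1 + z powr p\<close> turns the moment of order \<open>p\<close> into a
  uniform first moment bound.\<close>

lemma AE_envelope_series_finite_powr:
  assumes "p > 1" and m: "\<And>k. (\<integral>\<^sup>+\<omega>. ennreal (Z k \<omega> powr p) \<partial>M) \<le> ennreal m"
  shows "AE \<omega> in M. (\<integral>\<^sup>+k. ennreal (c t k * Z k \<omega>) \<partial>count_space UNIV) \<noteq> \<infinity>"
proof (rule AE_weighted_series_finite[where m = "1 + ennreal m"])
  fix k
  have "z \<le> 1 + z powr p" if "z \<ge> 0" for z :: real
    using assms(1) powr_mono[of 1 p z] that by (cases "z \<le> 1") (auto simp: add_increasing2)
  hence "(\<integral>\<^sup>+\<omega>. ennreal (Z k \<omega>) \<partial>M) \<le> (\<integral>\<^sup>+\<omega>. 1 + ennreal (Z k \<omega> powr p) \<partial>M)"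
    by (intro nn_integral_mono_AE eventually_mono[OF Z_nonneg[of k]])
      (simp flip: ennreal_1 ennreal_plus)
  also have "\<dots> \<le> 1 + ennreal m"
    using m[of k] by (simp add: nn_integral_add emeasure_space_1)
  finally show "(\<integral>\<^sup>+\<omega>. ennreal (Z k \<omega>) \<partial>M) \<le> 1 + ennreal m" .
qed (use nn_integral_c_le[of t] in \<open>auto simp: c_nonneg le_less_trans[OF _ ennreal_less_top]\<close>)

lemma nn_integral_envelope_powr_le:
  assumes "p > 1" and m: "\<And>k. (\<integral>\<^sup>+\<omega>. ennreal (Z k \<omega> powr p) \<partial>M) \<le> ennreal m" "0 \<le> m"
  shows "(\<integral>\<^sup>+\<omega>. ennreal (envelope t \<omega> powr p) \<partial>M) \<le> ennreal (K powr p * m)"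
  unfolding envelope_def
proof (rule nn_integral_weighted_series_le[where h = "\<lambda>x. x powr p"])
  show "continuous_on {0..} (\<lambda>x. x powr p)"
    using assms(1) by (intro continuous_on_powr') (auto intro: continuous_intros)
  show "(\<integral>\<^sup>+\<omega>. ennreal ((\<Sum>k\<in>F. c (int t) k * Z k \<omega>) powr p) \<partial>M) \<le> ennreal (K powr p * m)"
    if "finite F" for F
    by (intro nn_integral_powr_weighted_sum_le Z_borel AE_Z_nonneg c_nonneg sum_c_le that assms)
  show "AE \<omega> in M. (\<integral>\<^sup>+k. ennreal (c (int t) k * Z k \<omega>) \<partial>count_space UNIV) \<noteq> \<infinity>"
    by (rule AE_envelope_series_finite_powr[OF assms(1,2)])
qed (use AE_Z_nonneg c_nonneg in auto)

lemma mean_risk_grad_le: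
  assumes "\<eta> > 0" and m: "\<And>k. (\<integral>\<^sup>+\<omega>. ennreal (Z k \<omega> ^ 4) \<partial>M) \<le> ennreal m" "0 \<le> m"
    and \<nu>: "\<nu> \<in> prob_simplex N"
  shows "mean_risk M T X (grad_aggregate \<eta> N X Xh) \<le> mean_risk M T X (convex_predictor N \<nu> Xh)
    + ennreal (ln (real N) / \<eta> / real T + 2 * \<eta> * (K ^ 4 * m))"
proof -
  \<comment> \<open>Integer and real fourth powers agree on nonnegative values, hence almost
    surely.\<close>
  have m': "(\<integral>\<^sup>+\<omega>. ennreal (Z k \<omega> powr 4) \<partial>M) \<le> ennreal m" for k
  proof -
    have "(\<integral>\<^sup>+\<omega>. ennreal (Z k \<omega> powr 4) \<partial>M) = (\<integral>\<^sup>+\<omega>. ennreal (Z k \<omega> ^ 4) \<partial>M)"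
      by (intro nn_integral_cong_AE eventually_mono[OF Z_nonneg[of k]]) simp
    thus ?thesis using m by simp
  qed
  have fin: "AE \<omega> in M. (\<integral>\<^sup>+k. ennreal (c t k * Z k \<omega>) \<partial>count_space UNIV) \<noteq> \<infinity>" for t
    by (rule AE_envelope_series_finite_powr[OF _ m']) simp
  show ?thesis
  proof (rule mean_risk_le)
    fix t assume t: "t \<in> {1..T}"
    show "grad_aggregate \<eta> N X Xh t \<in> borel_measurable M"
      using t by (intro borel_measurable_grad_aggregate[where T = T]) auto
    have [measurable]: "Xh i t \<in> borel_measurable M" if "i \<in> {1..N}" for i
      using that t by auto
    show "convex_predictor N \<nu> Xh t \<in> borel_measurable M"
      unfolding convex_predictor_def[abs_def] by measurable
  next
    show "AE \<omega> in M. (\<Sum>t=1..T. (grad_aggregate \<eta> N X Xh t \<omega> - X (int t) \<omega>)\<^sup>2)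
        \<le> (\<Sum>t=1..T. (convex_predictor N \<nu> Xh t \<omega> - X (int t) \<omega>)\<^sup>2) + ln (real N) / \<eta>
          + (\<Sum>t=1..T. 2 * \<eta> * envelope t \<omega> ^ 4)"
      using AE_predictor_le_envelope[OF fin]
    proof eventually_elim
      case (elim \<omega>)
      show ?case
        unfolding grad_aggregate_def convex_predictor_def
        using assms(1) N \<nu> elim
        by (intro grad_weight_regret) (auto simp: prob_simplex_def)
    qed
  next
    fix t
    have "(\<integral>\<^sup>+\<omega>. ennreal (2 * \<eta> * envelope t \<omega> ^ 4) \<partial>M)
        = ennreal (2 * \<eta>) * (\<integral>\<^sup>+\<omega>. ennreal (envelope t \<omega> powr 4) \<partial>M)"
      using assms(1) by (simp add: ennreal_mult' envelope_nonneg nn_integral_cmult)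
    also have "\<dots> \<le> ennreal (2 * \<eta>) * ennreal (K powr 4 * m)"
      by (intro mult_left_mono nn_integral_envelope_powr_le m' m) auto
    also have "\<dots> = ennreal (2 * \<eta> * (K ^ 4 * m))"
      using assms(1) K_nonneg m(2) by (simp flip: ennreal_mult)
    finally show "(\<integral>\<^sup>+\<omega>. ennreal (2 * \<eta> * envelope t \<omega> ^ 4) \<partial>M) \<le> ennreal (2 * \<eta> * (K ^ 4 * m))" .
  qed (use assms(1) m(2) T N K_nonneg prob_space_axioms in \<open>auto simp: envelope_nonneg\<close>)
qed

text \<open>Leaves a single task for the quadratic strategy: bounding the expected excess of the
  squared envelope over \<open>1 / (2 * \<eta>)\<close>, once by power moments and once by
  exponential moments.\<close>

lemma mean_risk_quad_le:
  assumes "\<eta> > 0" and i: "i \<in> {1..N}" and "0 \<le> D"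
    and fin: "\<And>t. AE \<omega> in M. (\<integral>\<^sup>+k. ennreal (c t k * Z k \<omega>) \<partial>count_space UNIV) \<noteq> \<infinity>"
    and D: "\<And>t. (\<integral>\<^sup>+\<omega>. ennreal (max 0 ((envelope t \<omega>)\<^sup>2 - 1 / (2 * \<eta>))) \<partial>M) \<le> ennreal D"
  shows "mean_risk M T X (quad_aggregate \<eta> N X Xh)
    \<le> mean_risk M T X (Xh i) + ennreal (ln (real N) / \<eta> / real T + D)"
proof (rule mean_risk_le)
  fix t assume t: "t \<in> {1..T}"
  show "quad_aggregate \<eta> N X Xh t \<in> borel_measurable M"
    using t by (intro borel_measurable_quad_aggregate[where T = T]) auto
  show "Xh i t \<in> borel_measurable M" using i t by auto
next
  show "AE \<omega> in M. (\<Sum>t=1..T. (quad_aggregate \<eta> N X Xh t \<omega> - X (int t) \<omega>)\<^sup>2)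
      \<le> (\<Sum>t=1..T. (Xh i t \<omega> - X (int t) \<omega>)\<^sup>2) + ln (real N) / \<eta>
        + (\<Sum>t=1..T. max 0 ((envelope t \<omega>)\<^sup>2 - 1 / (2 * \<eta>)))"
    using AE_predictor_le_envelope[OF fin]
  proof eventually_elim
    case (elim \<omega>)
    have "\<bar>Xh j t \<omega> - X (int t) \<omega>\<bar> \<le> envelope t \<omega>" if "j \<in> {1..N}" "t \<in> {1..T}" for j t
    proof -
      have "\<bar>Xh j t \<omega>\<bar> + \<bar>X (int t) \<omega>\<bar> \<le> envelope t \<omega>" using elim that by blast
      thus ?thesis by linarith
    qed
    thus ?case
      unfolding quad_aggregate_def by (intro quad_weight_regret assms(1) i)
  qed
qed (use assms T N prob_space_axioms in auto)

lemma mean_risk_quad_powr_le: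
  assumes "\<eta> > 0" "p > 2" and m: "\<And>k. (\<integral>\<^sup>+\<omega>. ennreal (Z k \<omega> powr p) \<partial>M) \<le> ennreal m" "0 \<le> m"
    and i: "i \<in> {1..N}"
  shows "mean_risk M T X (quad_aggregate \<eta> N X Xh)
    \<le> mean_risk M T X (Xh i) + ennreal (ln (real N) / \<eta> / real T + (2 * \<eta>) powr (p / 2 - 1) * (K powr p * m))"
proof (rule mean_risk_quad_le)
  fix t
  have "(\<integral>\<^sup>+\<omega>. ennreal (max 0 ((envelope t \<omega>)\<^sup>2 - 1 / (2 * \<eta>))) \<partial>M)
      \<le> (\<integral>\<^sup>+\<omega>. ennreal ((2 * \<eta>) powr (p / 2 - 1)) * ennreal (envelope t \<omega> powr p) \<partial>M)"
    using excess_le_powr[OF assms(1,2) envelope_nonneg]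
    by (intro nn_integral_mono) (auto simp flip: ennreal_mult intro!: ennreal_leI)
  also have "\<dots> = ennreal ((2 * \<eta>) powr (p / 2 - 1)) * (\<integral>\<^sup>+\<omega>. ennreal (envelope t \<omega> powr p) \<partial>M)"
    by (simp add: nn_integral_cmult)
  also have "\<dots> \<le> ennreal ((2 * \<eta>) powr (p / 2 - 1)) * ennreal (K powr p * m)"
    using assms by (intro mult_left_mono nn_integral_envelope_powr_le) auto
  also have "\<dots> = ennreal ((2 * \<eta>) powr (p / 2 - 1) * (K powr p * m))"
    using m(2) by (simp flip: ennreal_mult)
  finally show "(\<integral>\<^sup>+\<omega>. ennreal (max 0 ((envelope t \<omega>)\<^sup>2 - 1 / (2 * \<eta>))) \<partial>M)
    \<le> ennreal ((2 * \<eta>) powr (p / 2 - 1) * (K powr p * m))" .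
  show "AE \<omega> in M. (\<integral>\<^sup>+k. ennreal (c t k * Z k \<omega>) \<partial>count_space UNIV) \<noteq> \<infinity>" for t
    using assms by (intro AE_envelope_series_finite_powr[where p = p and m = m]) auto
qed (use assms in auto)

text \<open>The upper end of the range of \<open>s\<close> matches the uniform bound on the
  coefficients, so every exponent \<open>s * c t k\<close> is admissible for the exponential moment
  at \<open>\<zeta>\<close>.\<close>

lemma c_le:
  assumes "ennreal s \<le> ennreal \<zeta> / (a_star A * (L_star L + 1))" "s > 0" "\<zeta> > 0"
  shows "s * c t k \<le> \<zeta>"
proof -
  have "a_star A * (L_star L + 1) < \<infinity>"
    using le_less_trans[OF a_star_le_A_star A_star_finite] L_star_finite
    by (simp add: ennreal_mult_less_top)
  then obtain q where q: "a_star A * (L_star L + 1) = ennreal q" "0 \<le> q"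
    by (cases "a_star A * (L_star L + 1)") auto
  have "ennreal (c t k) \<le> ennreal q"
    unfolding ennreal_c q(1)[symmetric] by (rule envelope_coeff_le)
  hence c: "c t k \<le> q" using q(2) by simp
  show ?thesis
  proof (cases "q = 0")
    \<comment> \<open>With \<open>q = 0\<close> the quotient is infinite and \<open>s\<close> is
      unrestricted, but then the coefficient vanishes.\<close>
    case True
    thus ?thesis using c c_nonneg[of t k] assms by simp
  next
    case False
    hence "s \<le> \<zeta> / q"
      using assms q by (simp add: divide_ennreal)
    hence "s * q \<le> \<zeta>" using False q(2) by (simp add: field_simps)
    moreover have "s * c t k \<le> s * q" using c assms(2) by simp
    ultimately show ?thesis by simp
  qed
qed

lemma mean_risk_quad_exp_le:
  assumes "\<eta> > 0" "s > 0" "\<zeta> > 0"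
    and \<phi>: "\<And>k. (\<integral>\<^sup>+\<omega>. ennreal (exp (\<zeta> * Z k \<omega>)) \<partial>M) \<le> ennreal \<phi>" "0 \<le> \<phi>"
    and indep: "indep_vars (\<lambda>_. borel) Z UNIV"
    and s: "ennreal s \<le> ennreal \<zeta> / (a_star A * (L_star L + 1))"
    and i: "i \<in> {1..N}"
  shows "mean_risk M T X (quad_aggregate \<eta> N X Xh)
    \<le> mean_risk M T X (Xh i) + ennreal (ln (real N) / \<eta> / real T
      + 2 / exp 1 * s powr (-2) * (2 + s * (2 * \<eta>) powr (-1/2)) * exp (- s * (2 * \<eta>) powr (-1/2))
        * \<phi> powr (s * K / \<zeta>))"
proof (rule mean_risk_quad_le)
  \<comment> \<open>\<open>Z 0\<close> is almost surely nonnegative, so its exponential moment is at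
    least one; hence \<open>\<phi> \<ge> 1\<close>, and powers of \<open>\<phi>\<close> are monotone
    in the exponent.\<close>
  have "1 \<le> (\<integral>\<^sup>+\<omega>. ennreal (exp (\<zeta> * Z 0 \<omega>)) \<partial>M)"
  proof -
    have "(\<integral>\<^sup>+\<omega>. 1 \<partial>M) \<le> (\<integral>\<^sup>+\<omega>. ennreal (exp (\<zeta> * Z 0 \<omega>)) \<partial>M)"
      using assms(3) by (intro nn_integral_mono_AE eventually_mono[OF Z_nonneg[of 0]]) simp
    thus ?thesis by (simp add: emeasure_space_1)
  qed
  with \<phi>(1)[of 0] have \<phi>1: "\<phi> \<ge> 1" by (metis ennreal_le_1 ennreal_1 ennreal_le_iff \<phi>(2) order_trans)
  show fin: "AE \<omega> in M. (\<integral>\<^sup>+k. ennreal (c t k * Z k \<omega>) \<partial>count_space UNIV) \<noteq> \<infinity>" for t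
  proof (rule AE_weighted_series_finite[where m = "ennreal (1 / \<zeta>) * ennreal \<phi>"])
    fix k
    have "z \<le> 1 / \<zeta> * exp (\<zeta> * z)" for z :: real
    proof -
      have "\<zeta> * z \<le> exp (\<zeta> * z)" using exp_ge_add_one_self[of "\<zeta> * z"] by linarith
      thus ?thesis using assms(3) by (simp add: field_simps)
    qed
    hence "(\<integral>\<^sup>+\<omega>. ennreal (Z k \<omega>) \<partial>M) \<le> (\<integral>\<^sup>+\<omega>. ennreal (1 / \<zeta>) * ennreal (exp (\<zeta> * Z k \<omega>)) \<partial>M)"
      using assms(3) by (intro nn_integral_mono) (simp flip: ennreal_mult)
    also have "\<dots> \<le> ennreal (1 / \<zeta>) * ennreal \<phi>"
      using \<phi>(1) by (simp add: nn_integral_cmult mult_left_mono)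
    finally show "(\<integral>\<^sup>+\<omega>. ennreal (Z k \<omega>) \<partial>M) \<le> ennreal (1 / \<zeta>) * ennreal \<phi>" .
  qed (use nn_integral_c_le[of t] in \<open>auto simp: c_nonneg ennreal_mult_less_top le_less_trans[OF _ ennreal_less_top]\<close>)
  define B where "B = 2 / exp 1 * s powr (-2) * (2 + s * (2 * \<eta>) powr (-1/2)) * exp (- s * (2 * \<eta>) powr (-1/2))"
  have "B \<ge> 0" using assms by (simp add: B_def)
  fix t
  have "(\<integral>\<^sup>+\<omega>. ennreal (max 0 ((envelope t \<omega>)\<^sup>2 - 1 / (2 * \<eta>))) \<partial>M)
      \<le> (\<integral>\<^sup>+\<omega>. ennreal B * ennreal (exp (s * envelope t \<omega>)) \<partial>M)"
    using excess_le_exp[OF assms(1,2) envelope_nonneg, folded B_def] \<open>B \<ge> 0\<close>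
    by (intro nn_integral_mono) (auto simp flip: ennreal_mult intro!: ennreal_leI)
  also have "\<dots> = ennreal B * (\<integral>\<^sup>+\<omega>. ennreal (exp (s * envelope t \<omega>)) \<partial>M)"
    by (simp add: nn_integral_cmult)
  also have "(\<integral>\<^sup>+\<omega>. ennreal (exp (s * envelope t \<omega>)) \<partial>M) \<le> ennreal (\<phi> powr (s * K / \<zeta>))"
    unfolding envelope_def
    by (rule nn_integral_weighted_series_le[where h = "\<lambda>x. exp (s * x)"])
      (use assms \<phi>1 fin in \<open>auto intro!: AE_Z_nonneg c_nonneg c_le
        nn_integral_exp_weighted_sum_le sum_c_le continuous_intros\<close>)
  finally show "(\<integral>\<^sup>+\<omega>. ennreal (max 0 ((envelope t \<omega>)\<^sup>2 - 1 / (2 * \<eta>))) \<partial>M) \<le> ennreal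
      (2 / exp 1 * s powr (-2) * (2 + s * (2 * \<eta>) powr (-1/2)) * exp (- s * (2 * \<eta>) powr (-1/2))
        * \<phi> powr (s * K / \<zeta>))"
    unfolding B_def[symmetric] using \<open>B \<ge> 0\<close> by (simp add: ennreal_mult mult_left_mono)
qed (use assms in auto)

end

theorem theorem2p1:
  fixes M :: "'a measure"
    and X Z :: "int \<Rightarrow> 'a \<Rightarrow> real"
    and A :: "int \<Rightarrow> int \<Rightarrow> real"
    and L :: "nat \<Rightarrow> real"
    and Xh :: "nat \<Rightarrow> nat \<Rightarrow> 'a \<Rightarrow> real"
    and T N :: nat
  assumes "prob_space M"
    and "T \<ge> 1" and "N \<ge> 1"
    and "\<And>t. X t \<in> borel_measurable M"
    and "\<And>t. Z t \<in> borel_measurable M"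
    and "\<And>t. AE \<omega> in M. 0 \<le> Z t \<omega>"
    and "\<And>t j. 0 \<le> A t j"
    and "A_star A < \<infinity>"
    and "sublinear_process M A Z X"
    and "\<And>s. s \<ge> 1 \<Longrightarrow> 0 \<le> L s"
    and "L_star L < \<infinity>"
    and "\<And>i t. i \<in> {1..N} \<Longrightarrow> t \<in> {1..T} \<Longrightarrow> Lipschitz_predictor M X L (int t) (Xh i t)"
  shows
    "(let As = enn2real (A_star A); Ls = enn2real (L_star L) in
      (let m4 = (SUP t. \<integral>\<^sup>+\<omega>. ennreal (Z t \<omega> ^ 4) \<partial>M) in
        m4 < \<infinity> \<longrightarrow>
        (\<forall>\<eta>>0. mean_risk M T X (grad_aggregate \<eta> N X Xh)
           \<le> (INF \<nu>\<in>prob_simplex N. mean_risk M T X (convex_predictor N \<nu> Xh))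
             + ennreal (ln (real N) / (real T * \<eta>)
                        + 2 * \<eta> * (1 + Ls) ^ 4 * As ^ 4 * enn2real m4)))
      \<and>
      (\<forall>p>2. let mp = (SUP t. \<integral>\<^sup>+\<omega>. ennreal (Z t \<omega> powr p) \<partial>M) in
        mp < \<infinity> \<longrightarrow>
        (\<forall>\<eta>>0. mean_risk M T X (quad_aggregate \<eta> N X Xh)
           \<le> (MIN i\<in>{1..N}. mean_risk M T X (Xh i))
             + ennreal (ln (real N) / (real T * \<eta>)
                        + (2 * \<eta>) powr (p / 2 - 1) * As powr p * (1 + Ls) powr p * enn2real mp)))
      \<and>
      (\<forall>\<zeta>>0. let \<phi> = (SUP t. \<integral>\<^sup>+\<omega>. ennreal (exp (\<zeta> * Z t \<omega>)) \<partial>M) in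
        prob_space.indep_vars M (\<lambda>_. borel) Z UNIV \<and> \<phi> < \<infinity> \<longrightarrow>
        a_star A \<le> A_star A \<and>
        (\<forall>\<eta>>0. \<forall>lam>0. ennreal lam \<le> ennreal \<zeta> / (a_star A * (L_star L + 1)) \<longrightarrow>
           mean_risk M T X (quad_aggregate \<eta> N X Xh)
           \<le> (MIN i\<in>{1..N}. mean_risk M T X (Xh i))
             + ennreal (ln (real N) / (real T * \<eta>)
                        + 2 / exp 1 * lam powr (-2) * (2 + lam * (2 * \<eta>) powr (-1/2))
                          * exp (- lam * (2 * \<eta>) powr (-1/2))
                          * enn2real \<phi> powr (lam * As * (1 + Ls) / \<zeta>)))))"
proof -
  interpret prob_space M by fact
  interpret sublinear_prediction M X Z A L Xh T N
    by unfold_locales (use assms in auto)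
  \<comment> \<open>No attained minimiser is required: moving the finite term \<open>e\<close> to
    the left by subtraction leaves a lower bound that is checked for each
    \<open>\<nu>\<close>.\<close>
  have INF_le: "x \<le> (INF \<nu>\<in>S. f \<nu>) + ennreal e" if "\<And>\<nu>. \<nu> \<in> S \<Longrightarrow> x \<le> f \<nu> + ennreal e"
    for x :: ennreal and f :: "(nat \<Rightarrow> real) \<Rightarrow> ennreal" and S e
  proof -
    have "x - ennreal e \<le> (INF \<nu>\<in>S. f \<nu>)"
      using that by (intro INF_greatest) (simp add: ennreal_minus_le_iff add.commute)
    thus ?thesis by (simp add: ennreal_minus_le_iff add.commute)
  qed
  have MIN_le: "x \<le> (MIN i\<in>{1..N}. f i) + ennreal e" if "\<And>i. i \<in> {1..N} \<Longrightarrow> x \<le> f i + ennreal e"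
    for x :: ennreal and f e
  proof -
    have "(MIN i\<in>{1..N}. f i) \<in> f ` {1..N}"
      using N by (intro Min_in) auto
    thus ?thesis using that by auto
  qed
  \<comment> \<open>A finite supremum equals the \<open>ennreal\<close> of its real value, so that
    real value serves as the uniform moment bound.\<close>
  have sup_le: "(\<integral>\<^sup>+\<omega>. ennreal (f k \<omega>) \<partial>M) \<le> ennreal (enn2real (SUP t. \<integral>\<^sup>+\<omega>. ennreal (f t \<omega>) \<partial>M))"
    if "(SUP t. \<integral>\<^sup>+\<omega>. ennreal (f t \<omega>) \<partial>M) < \<infinity>" for f :: "int \<Rightarrow> 'a \<Rightarrow> real" and k
  proof -
    have "(\<integral>\<^sup>+\<omega>. ennreal (f k \<omega>) \<partial>M) \<le> (SUP t. \<integral>\<^sup>+\<omega>. ennreal (f t \<omega>) \<partial>M)"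
      by (rule SUP_upper) simp
    thus ?thesis using that by simp
  qed
  show ?thesis
    unfolding Let_def
  proof (intro conjI allI impI, goal_cases)
    case (1 \<eta>)
    show ?case
      using mean_risk_grad_le[OF 1(2) sup_le[OF 1(1)] enn2real_nonneg]
      by (intro INF_le) (simp add: K_def power_mult_distrib mult_ac)
  next
    case (2 p \<eta>)
    show ?case
      using mean_risk_quad_powr_le[OF 2(3,1) sup_le[OF 2(2)] enn2real_nonneg]
      by (intro MIN_le) (simp add: K_def powr_mult mult_ac)
  next
    case 3
    show ?case by (rule a_star_le_A_star)
  next
    case (4 \<zeta> \<eta> lam)
    hence "indep_vars (\<lambda>_. borel) Z UNIV" "(SUP t. \<integral>\<^sup>+\<omega>. ennreal (exp (\<zeta> * Z t \<omega>)) \<partial>M) < \<infinity>" by auto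
    from mean_risk_quad_exp_le[OF 4(3,4,1) sup_le[OF this(2)] enn2real_nonneg this(1) 4(5)]
    show ?case
      by (intro MIN_le) (simp add: K_def mult.assoc divide_divide_eq_left mult.commute[of \<eta>])
  qed
qed

end
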